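(* There is a universal constant $c>0$ such that the following holds. Fix $k\in\mathbb{N}$ and $\varepsilon\in(0,\tfrac12)$. Let $G$ be a transitive subgroup of $S_k$ with $|G|\le 2^{k/2}$. Then every $M\subset\mathbb{F}_2^k$ with $|\mathbb{F}_2^k\setminus M|\le 2^k/\sqrt{\log k}$ satisfies $$\mathsf{c}_1\Big(M/G,\ d_{\mathbb{F}_2^k/G}^{1-\varepsilon}\Big)\ \ge\ c\,(\log k)^{\frac12-\varepsilon}.$$
   Context: $\mathbb{F}_2^k$ is equipped with the Hamming metric $d_{\mathbb{F}_2^k}(x,y)=|\{j:x_j\ne y_j\}|$. The symmetric group $S_k$ acts on $\mathbb{F}_2^k$ by permuting coordinates, $gx=(x_{g^{-1}(1)},\dots,x_{g^{-1}(k)})$; $G\le S_k$ is transitive if it acts transitively on $\{1,\dots,k\}$. The quotient metric on the set of orbits $\mathbb{F}_2^k/G=\{Gx\}$ is $d_{\mathbb{F}_2^k/G}(Gx,Gy)=\min_{g\in G}d_{\mathbb{F}_2^k}(gx,y)$, and $M/G=\{Gx: x\in M\}$ carries the restriction of this metric; $d^{1-\varepsilon}_{\mathbb{F}_2^k/G}$ denotes the metric $d_{\mathbb{F}_2^k/G}(\cdot,\cdot)^{1-\varepsilon}$. For a metric space $(U,d_U)$, $\mathsf{c}_1(U,d_U)$ is the infimum of $\alpha\ge1$ such that there exist an $L_1(\mu)$ space, a map $f:U\to L_1(\mu)$ and $\lambda>0$ with $\lambda d_U(x,y)\le\|f(x)-f(y)\|_1\le\alpha\lambda d_U(x,y)$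 for all $x,y\in U$. *)

theory Defs
  imports
    "HOL-Analysis.Analysis"
    "HOL-Library.Z2"
    "HOL-Algebra.Sym_Groups"
    "HOL-Algebra.Group_Action"
begin

section \<open>The Hamming cube and its quotients\<close>

text \<open>Coordinates are indexed by \<open>1, \<dots>, k\<close>; \<^typ>\<open>bit\<close> is the field with two elements.
  Outside \<open>{1..k}\<close> the value of a point is fixed to \<^const>\<open>undefined\<close>,
  so that the cube has exactly \<open>2 ^ k\<close> elements.\<close>

definition cube :: "nat \<Rightarrow> (nat \<Rightarrow> bit) set" where
  "cube k = {1..k} \<rightarrow>\<^sub>E (UNIV :: bit set)"

definition hamming :: "nat \<Rightarrow> (nat \<Rightarrow> bit) \<Rightarrow> (nat \<Rightarrow> bit) \<Rightarrow> nat" where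
  "hamming k x y = card {j \<in> {1..k}. x j \<noteq> y j}"

definition coord_action :: "(nat \<Rightarrow> nat) \<Rightarrow> (nat \<Rightarrow> bit) \<Rightarrow> (nat \<Rightarrow> bit)" where
  "coord_action g x = (\<lambda>j. x (inv' g j))"

definition transitive_perms :: "nat \<Rightarrow> (nat \<Rightarrow> nat) set \<Rightarrow> bool" where
  "transitive_perms k G \<longleftrightarrow> (\<forall>i\<in>{1..k}. \<forall>j\<in>{1..k}. \<exists>g\<in>G. g i = j)"

definition cube_orbit :: "nat \<Rightarrow> (nat \<Rightarrow> nat) set \<Rightarrow> (nat \<Rightarrow> bit) \<Rightarrow> (nat \<Rightarrow> bit) set" where
  "cube_orbit k G x = orbit (sym_group k\<lparr>carrier := G\<rparr>) coord_action x"

text \<open>The distance of two orbits, written without a choice of representatives. The formula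
  \<open>min\<^bsub>g \<in> G\<^esub> hamming (g x) y\<close> in terms of representatives is \<open>orbit_dist_cube_orbit\<close> below.\<close>

definition orbit_dist :: "nat \<Rightarrow> (nat \<Rightarrow> bit) set \<Rightarrow> (nat \<Rightarrow> bit) set \<Rightarrow> nat" where
  "orbit_dist k A B = Min {hamming k a b | a b. a \<in> A \<and> b \<in> B}"

lemma hamming_coord_action:
  assumes "g permutes {1..k}"
  shows "hamming k (coord_action g x) (coord_action g y) = hamming k x y"
proof -
  let ?D = "\<lambda>x y. {j \<in> {1..k}. x j \<noteq> y j}"
  have "?D (coord_action g x) (coord_action g y) = g ` ?D x y" (is "?L = _")
  proof
    show "?L \<subseteq> g ` ?D x y"
    proof
      fix j assume "j \<in> ?L"
      then have "inv' g j \<in> ?D x y"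
        using permutes_in_image[OF permutes_inv[OF assms], of j] by (auto simp: coord_action_def)
      then show "j \<in> g ` ?D x y" using permutes_inverses(1)[OF assms, of j] by (metis imageI)
    qed
    show "g ` ?D x y \<subseteq> ?L"
    proof
      fix j assume "j \<in> g ` ?D x y"
      then obtain i where "i \<in> ?D x y" "j = g i" by blast
      then show "j \<in> ?L"
        using permutes_in_image[OF assms, of i]
        by (auto simp: coord_action_def permutes_inverses(2)[OF assms])
    qed
  qed
  moreover have "inj_on g (?D x y)" using permutes_inj_on[OF assms] .
  ultimately show ?thesis unfolding hamming_def by (simp add: card_image)
qed

lemma coord_action_comp:
  assumes "g permutes {1..k}" "h permutes {1..k}"
  shows "coord_action g (coord_action h x) = coord_action (g \<circ> h) x"
  using assms by (simp add: coord_action_def o_inv_distrib permutes_bij)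

lemma orbit_dist_cube_orbit:
  assumes G: "subgroup G (sym_group k)"
  shows "orbit_dist k (cube_orbit k G x) (cube_orbit k G y) =
    Min ((\<lambda>g. hamming k (coord_action g x) y) ` G)"
proof -
  have perm: "g permutes {1..k}" if "g \<in> G" for g
    using subgroup.subset[OF G] that by (auto simp: sym_group_def)
  have mult: "g \<circ> h \<in> G" if "g \<in> G" "h \<in> G" for g h
    using subgroup.m_closed[OF G that] by (simp add: sym_group_def)
  have inv: "inv' g \<in> G" if "g \<in> G" for g
  proof -
    have "g \<in> carrier (sym_group k)" using perm[OF that] by (simp add: sym_group_def)
    then show ?thesis using subgroup.m_inv_closed[OF G that] by simp
  qed
  have one: "id \<in> G" using subgroup.one_closed[OF G] by (simp add: sym_group_def)
  have id: "coord_action id z = z" for z by (simp add: coord_action_def)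
  have "{hamming k a b | a b. a \<in> cube_orbit k G x \<and> b \<in> cube_orbit k G y} =
      (\<lambda>g. hamming k (coord_action g x) y) ` G" (is "?L = ?R")
  proof
    show "?L \<subseteq> ?R"
    proof
      fix n assume "n \<in> ?L"
      then obtain g h where gh: "g \<in> G" "h \<in> G"
        and n: "n = hamming k (coord_action g x) (coord_action h y)"
        by (auto simp: cube_orbit_def orbit_def)
      have p: "inv' h permutes {1..k}" using perm inv gh by blast
      have "coord_action (inv' h) (coord_action h y) = y"
        using perm[OF gh(2)] p by (simp add: coord_action_comp[OF p] permutes_inv_o id)
      then have "n = hamming k (coord_action (inv' h \<circ> g) x) y"
        using hamming_coord_action[OF p, of "coord_action g x" "coord_action h y"]
        by (simp add: n coord_action_comp[OF p perm[OF gh(1)]])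
      then show "n \<in> ?R" using mult[OF inv[OF gh(2)] gh(1)] by blast
    qed
    show "?R \<subseteq> ?L"
    proof
      fix n assume "n \<in> ?R"
      then obtain g where "g \<in> G" "n = hamming k (coord_action g x) (coord_action id y)"
        by (auto simp: id)
      then show "n \<in> ?L" using one by (force simp: cube_orbit_def orbit_def)
    qed
  qed
  then show ?thesis unfolding orbit_dist_def by simp
qed


section \<open>Distortion in \<open>L\<^sub>1\<close> spaces\<close>

text \<open>A map into \<open>L\<^sub>1(\<mu>)\<close> is given by integrable representatives.\<close>

definition embeds_L1 :: "'b measure \<Rightarrow> 'a set \<Rightarrow> ('a \<Rightarrow> 'a \<Rightarrow> real) \<Rightarrow> real \<Rightarrow> bool" where
  "embeds_L1 \<mu> U d \<alpha> \<longleftrightarrow> (\<exists>f :: 'a \<Rightarrow> 'b \<Rightarrow> real. \<exists>s>0.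
     (\<forall>x\<in>U. integrable \<mu> (f x)) \<and>
     (\<forall>x\<in>U. \<forall>y\<in>U. s * d x y \<le> (\<integral>\<omega>. \<bar>f x \<omega> - f y \<omega>\<bar> \<partial>\<mu>) \<and>
                    (\<integral>\<omega>. \<bar>f x \<omega> - f y \<omega>\<bar> \<partial>\<mu>) \<le> \<alpha> * s * d x y))"

text \<open>HOL cannot quantify over measures on all types inside a definition. The measures on
  \<^typ>\<open>'a \<Rightarrow> real\<close> suffice for embedding subsets of \<^typ>\<open>'a\<close>: push the given measure forward
  along \<open>\<omega> \<mapsto> (f x \<omega>)\<^sub>x\<close>.\<close>

lemma embeds_L1_universal:
  fixes \<mu> :: "'b measure" and U :: "'a set"
  assumes "embeds_L1 \<mu> U d \<alpha>"
  shows "\<exists>\<nu> :: ('a \<Rightarrow> real) measure. embeds_L1 \<nu> U d \<alpha>"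
proof -
  obtain f :: "'a \<Rightarrow> 'b \<Rightarrow> real" and l where l: "l > 0"
    and int: "\<And>x. x \<in> U \<Longrightarrow> integrable \<mu> (f x)"
    and f: "\<And>x y. x \<in> U \<Longrightarrow> y \<in> U \<Longrightarrow> l * d x y \<le> (\<integral>\<omega>. \<bar>f x \<omega> - f y \<omega>\<bar> \<partial>\<mu>) \<and>
       (\<integral>\<omega>. \<bar>f x \<omega> - f y \<omega>\<bar> \<partial>\<mu>) \<le> \<alpha> * l * d x y"
    using assms unfolding embeds_L1_def by blast
  define F where "F = (\<lambda>\<omega> x. if x \<in> U then f x \<omega> else 0)"
  define P :: "('a \<Rightarrow> real) measure" where "P = PiM UNIV (\<lambda>_. borel)"
  have F: "F \<in> measurable \<mu> P"
    unfolding F_def P_def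
  proof (rule measurable_abs_UNIV)
    show "(\<lambda>\<omega>. if x \<in> U then f x \<omega> else 0) \<in> borel_measurable \<mu>" for x
      using borel_measurable_integrable[OF int] by (cases "x \<in> U") auto
  qed
  have comp[measurable]: "(\<lambda>z. z x) \<in> borel_measurable P" for x
    unfolding P_def by (rule measurable_component_singleton) simp
  have "integrable (distr \<mu> P F) (\<lambda>z. z x)" if "x \<in> U" for x
    using int[OF that] that by (subst integrable_distr_eq[OF F comp]) (simp add: F_def)
  moreover have "(\<integral>z. \<bar>z x - z y\<bar> \<partial>distr \<mu> P F) = (\<integral>\<omega>. \<bar>f x \<omega> - f y \<omega>\<bar> \<partial>\<mu>)"
    if "x \<in> U" "y \<in> U" for x y
    using that by (subst integral_distr[OF F]) (auto simp: F_def)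
  ultimately have "embeds_L1 (distr \<mu> P F) U d \<alpha>"
    unfolding embeds_L1_def using l f
    by (intro exI[of _ "\<lambda>x z. z x"] exI[of _ l]) auto
  then show ?thesis by blast
qed

text \<open>The value is \<open>\<infinity>\<close> when there is no embedding of finite distortion.\<close>

definition c1 :: "'a set \<Rightarrow> ('a \<Rightarrow> 'a \<Rightarrow> real) \<Rightarrow> ereal" where
  "c1 U d = Inf {ereal \<alpha> | \<alpha>. \<alpha> \<ge> 1 \<and> (\<exists>\<mu> :: ('a \<Rightarrow> real) measure. embeds_L1 \<mu> U d \<alpha>)}"

end

theory Submission
  imports Defs
begin

text \<open>
  Let \<open>m\<close> be of order \<open>sqrt (ln k)\<close> and let \<open>y\<close> be obtained from a uniform \<open>x\<close> by flipping each
  coordinate independently with probability \<open>t\<close>, where \<open>1 - 2 t = cos (\<pi> / (2 m))\<close>. The heart of the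
  matter is that a \<open>G\<close>-invariant \<open>f\<close> with values \<open>\<plusminus>1\<close> has variance at most of order \<open>m P(f x \<noteq> f y)\<close>.
  The part \<open>Q\<close> of \<open>f\<close> of degree at most \<open>2 m\<^sup>2\<close> is close to \<open>f\<close> in \<open>L\<^sub>2\<close>, since the noise would
  detect a heavy tail. Evaluate \<open>Q\<close> along the path \<open>cos (j \<theta>) u + sin (j \<theta>) v\<close>, \<open>\<theta> = \<pi> / (2 m)\<close>,
  between independent sign vectors \<open>u\<close> and \<open>v\<close>. By transitivity all influences of \<open>Q\<close> are equal, hence
  tiny, so by Lindeberg replacement and Bonami's lemma \<open>Q\<close> stays near \<open>\<plusminus>1\<close> at every point of the path;
  a sign change in one of the \<open>m\<close> steps thus forces a jump of \<open>Q\<close>, whose mean square is controlled by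
  \<open>P(f x \<noteq> f y)\<close>. This subadditivity argument is a discrete version of the one of Kindler and
  O'Donnell in Gauss space, and it avoids Bourgain's noise sensitivity theorem.

  Integrating over level sets gives the same inequality for \<open>L\<^sub>1\<close>-valued invariant maps. A map on
  \<open>M / G\<close> is extended to the cube through a nearest orbit, which costs \<open>sqrt k\<close> on average by the
  Poincare inequality. Independent points are at distance at least \<open>k / 50\<close> since \<open>G\<close> is small, while
  noisy pairs are at distance of order \<open>k / ln k\<close>; comparing the two sides gives the bound.
\<close>

section \<open>Expectations over finite product spaces\<close>

definition pexp :: "('w::finite \<Rightarrow> real) \<Rightarrow> 'i set \<Rightarrow> (('i \<Rightarrow> 'w) \<Rightarrow> real) \<Rightarrow> real" where
  "pexp p I F = (\<Sum>\<tau>\<in>I \<rightarrow>\<^sub>E UNIV. (\<Prod>i\<in>I. p (\<tau> i)) * F \<tau>)"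

definition prob_weight :: "('w::finite \<Rightarrow> real) \<Rightarrow> bool" where
  "prob_weight p \<longleftrightarrow> (\<forall>a. p a \<ge> 0) \<and> (\<Sum>a\<in>UNIV. p a) = 1"

lemma prob_weight_nonneg: "prob_weight p \<Longrightarrow> p a \<ge> 0"
  and prob_weight_sum: "prob_weight p \<Longrightarrow> (\<Sum>a\<in>UNIV. p a) = 1"
  by (simp_all add: prob_weight_def)

lemma pexp_empty [simp]: "pexp p {} F = F (\<lambda>_. undefined)"
  by (simp add: pexp_def)

text \<open>Fubini for one coordinate: the value at \<open>i\<close> is averaged first. Every
  induction over the index set below peels off a coordinate in this way.\<close>

lemma pexp_insert:
  assumes "finite I" "i \<notin> I"
  shows "pexp p (insert i I) F = pexp p I (\<lambda>\<tau>. \<Sum>a\<in>UNIV. p a * F (\<tau>(i := a)))"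
proof -
  let ?W = "\<lambda>\<tau>. \<Prod>j\<in>insert i I. p (\<tau> j)"
  have "pexp p (insert i I) F =
      (\<Sum>(a, \<tau>)\<in>UNIV \<times> (I \<rightarrow>\<^sub>E UNIV). ?W (\<tau>(i := a)) * F (\<tau>(i := a)))"
    unfolding pexp_def PiE_insert_eq
    by (subst sum.reindex[OF inj_combinator[OF assms(2)]]) (simp add: case_prod_beta o_def)
  also have "\<dots> = (\<Sum>\<tau>\<in>I \<rightarrow>\<^sub>E UNIV. \<Sum>a\<in>UNIV. ?W (\<tau>(i := a)) * F (\<tau>(i := a)))"
    by (subst sum.swap) (simp add: sum.cartesian_product)
  also have "\<dots> = pexp p I (\<lambda>\<tau>. \<Sum>a\<in>UNIV. p a * F (\<tau>(i := a)))"
    unfolding pexp_def sum_distrib_left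
  proof (intro sum.cong refl)
    fix \<tau> a
    have "(\<Prod>j\<in>I. p ((\<tau>(i := a)) j)) = (\<Prod>j\<in>I. p (\<tau> j))"
      using assms(2) by (intro prod.cong) auto
    then show "?W (\<tau>(i := a)) * F (\<tau>(i := a)) =
        (\<Prod>j\<in>I. p (\<tau> j)) * (p a * F (\<tau>(i := a)))"
      using assms by simp
  qed
  finally show ?thesis .
qed

lemma pexp_add: "pexp p I (\<lambda>\<tau>. F \<tau> + H \<tau>) = pexp p I F + pexp p I H"
  by (simp add: pexp_def sum.distrib ring_distribs)

lemma pexp_diff: "pexp p I (\<lambda>\<tau>. F \<tau> - H \<tau>) = pexp p I F - pexp p I H"
  by (simp add: pexp_def sum_subtractf ring_distribs)

lemma pexp_cmult: "pexp p I (\<lambda>\<tau>. c * F \<tau>) = c * pexp p I F"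
  by (simp add: pexp_def sum_distrib_left mult.left_commute)

lemma pexp_sum: "pexp p I (\<lambda>\<tau>. \<Sum>x\<in>A. T x \<tau>) = (\<Sum>x\<in>A. pexp p I (T x))"
  unfolding pexp_def sum_distrib_left by (rule sum.swap)

lemma pexp_cong:
  "(\<And>\<tau>. \<tau> \<in> I \<rightarrow>\<^sub>E UNIV \<Longrightarrow> F \<tau> = H \<tau>) \<Longrightarrow> pexp p I F = pexp p I H"
  by (simp add: pexp_def)

lemma pexp_mono:
  assumes "prob_weight p" "\<And>\<tau>. \<tau> \<in> I \<rightarrow>\<^sub>E UNIV \<Longrightarrow> F \<tau> \<le> H \<tau>"
  shows "pexp p I F \<le> pexp p I H"
  unfolding pexp_def
  using assms by (intro sum_mono mult_left_mono prod_nonneg) (auto simp: prob_weight_nonneg)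

lemma pexp_const:
  assumes "prob_weight p" "finite I"
  shows "pexp p I (\<lambda>_. c) = c"
  using assms(2)
  by (induction I rule: finite_induct)
    (simp_all add: pexp_insert prob_weight_sum[OF assms(1)] flip: sum_distrib_right)

lemma pexp_nonneg:
  assumes "prob_weight p" "\<And>\<tau>. \<tau> \<in> I \<rightarrow>\<^sub>E UNIV \<Longrightarrow> F \<tau> \<ge> 0"
  shows "pexp p I F \<ge> 0"
  using pexp_mono[OF assms(1), of I "\<lambda>_. 0" F] assms(2) by (simp add: pexp_def)

lemma abs_pexp_le:
  assumes "prob_weight p"
  shows "\<bar>pexp p I F\<bar> \<le> pexp p I (\<lambda>\<tau>. \<bar>F \<tau>\<bar>)"
proof -
  have "pexp p I (\<lambda>\<tau>. - 1 * F \<tau>) \<le> pexp p I (\<lambda>\<tau>. \<bar>F \<tau>\<bar>)"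
    and "pexp p I F \<le> pexp p I (\<lambda>\<tau>. \<bar>F \<tau>\<bar>)"
    using assms by (auto intro!: pexp_mono)
  then show ?thesis unfolding pexp_cmult by simp
qed

text \<open>Independent coordinates stay independent under a coordinatewise map, and each acquires
  the push-forward law, which collects the fibres of \<open>g\<close>. This yields the marginals of
  a random pair.\<close>

lemma pexp_image:
  fixes p :: "'v::finite \<Rightarrow> real" and g :: "'v \<Rightarrow> 'w::finite"
  assumes "finite I" and q: "\<And>b. q b = (\<Sum>a | g a = b. p a)"
  shows "pexp p I (\<lambda>\<tau>. F (\<lambda>i\<in>I. g (\<tau> i))) = pexp q I F"
  using assms(1)
proof (induction I arbitrary: F rule: finite_induct)
  case empty
  then show ?case by (simp add: restrict_def)
next
  case (insert i I)
  have *: "(\<Sum>a\<in>UNIV. p a * F (\<lambda>j\<in>insert i I. g ((\<tau>(i := a)) j))) =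
      (\<Sum>b\<in>UNIV. q b * F ((\<lambda>j\<in>I. g (\<tau> j))(i := b)))" for \<tau>
  proof -
    have "(\<lambda>j\<in>insert i I. g ((\<tau>(i := a)) j)) = (\<lambda>j\<in>I. g (\<tau> j))(i := g a)" for a
      using insert.hyps by (auto simp: restrict_def fun_eq_iff)
    then have "(\<Sum>a\<in>UNIV. p a * F (\<lambda>j\<in>insert i I. g ((\<tau>(i := a)) j))) =
        (\<Sum>a\<in>UNIV. p a * F ((\<lambda>j\<in>I. g (\<tau> j))(i := g a)))"
      by simp
    also have "\<dots> = (\<Sum>b\<in>UNIV. \<Sum>a | g a = b. p a * F ((\<lambda>j\<in>I. g (\<tau> j))(i := g a)))"
      using sum.group[of UNIV UNIV g "\<lambda>a. p a * F ((\<lambda>j\<in>I. g (\<tau> j))(i := g a))"] by simp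
    also have "\<dots> = (\<Sum>b\<in>UNIV. q b * F ((\<lambda>j\<in>I. g (\<tau> j))(i := b)))"
      unfolding q sum_distrib_right by (intro sum.cong refl) auto
    finally show ?thesis .
  qed
  show ?case
    unfolding pexp_insert[OF insert.hyps] *
    by (rule insert.IH[of "\<lambda>x. \<Sum>b\<in>UNIV. q b * F (x(i := b))"])
qed

section \<open>Multilinear polynomials\<close>

text \<open>Over sign vectors this is a Walsh expansion. Arbitrary real arguments are allowed
  because the same polynomial is later evaluated at rotated variables.\<close>

definition mlin :: "('i set \<Rightarrow> real) \<Rightarrow> 'i set \<Rightarrow> ('i \<Rightarrow> real) \<Rightarrow> real" where
  "mlin a I z = (\<Sum>S\<in>Pow I. a S * (\<Prod>i\<in>S. z i))"

lemma inj_on_insert_Pow: "i \<notin> I \<Longrightarrow> inj_on (insert i) (Pow I)"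
  by (intro inj_onI) (metis PowD insert_ident subsetD)

lemma sum_Pow_insert:
  assumes "finite I" "i \<notin> I"
  shows "(\<Sum>S\<in>Pow (insert i I). f S) = (\<Sum>S\<in>Pow I. f S) + (\<Sum>S\<in>Pow I. f (insert i S))"
proof -
  have "Pow I \<inter> insert i ` Pow I = {}" using assms by auto
  then show ?thesis
    using assms by (simp add: Pow_insert sum.union_disjoint sum.reindex[OF inj_on_insert_Pow])
qed

lemma mlin_insert:
  assumes "finite I" "i \<notin> I"
  shows "mlin a (insert i I) z = mlin a I z + z i * mlin (\<lambda>S. a (insert i S)) I z"
proof -
  have "a (insert i S) * (\<Prod>j\<in>insert i S. z j) = z i * (a (insert i S) * (\<Prod>j\<in>S. z j))"
    if "S \<in> Pow I" for S
  proof -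
    have "finite S" "i \<notin> S" using that assms finite_subset by auto
    then show ?thesis by simp
  qed
  then show ?thesis
    unfolding mlin_def sum_Pow_insert[OF assms] sum_distrib_left
    by (metis (no_types, lifting) sum.cong)
qed

lemma mlin_cong: "(\<And>i. i \<in> I \<Longrightarrow> z i = z' i) \<Longrightarrow> mlin a I z = mlin a I z'"
  unfolding mlin_def by (intro sum.cong arg_cong2[of _ _ _ _ "(*)"] prod.cong refl) auto

lemma mlin_upd:
  "i \<notin> I \<Longrightarrow> mlin a I (\<lambda>j. \<zeta> j ((\<tau>(i := w)) j)) = mlin a I (\<lambda>j. \<zeta> j (\<tau> j))"
  by (rule mlin_cong) auto

text \<open>Orthogonality of monomials: for two different sets, a coordinate lying in only one of
  them averages to 0, and on the diagonal independence multiplies the covariances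
  \<open>r i\<close>. The induction on \<open>I\<close> splits both polynomials at one variable,
  whose cross terms vanish.\<close>

lemma pexp_mlin_mult:
  fixes \<zeta> \<zeta>' :: "'i \<Rightarrow> 'w::finite \<Rightarrow> real"
  assumes "prob_weight p" "finite I"
    and "\<And>i. i \<in> I \<Longrightarrow> (\<Sum>w\<in>UNIV. p w * \<zeta> i w) = 0"
    and "\<And>i. i \<in> I \<Longrightarrow> (\<Sum>w\<in>UNIV. p w * \<zeta>' i w) = 0"
    and "\<And>i. i \<in> I \<Longrightarrow> (\<Sum>w\<in>UNIV. p w * (\<zeta> i w * \<zeta>' i w)) = r i"
  shows "pexp p I (\<lambda>\<tau>. mlin a I (\<lambda>i. \<zeta> i (\<tau> i)) * mlin b I (\<lambda>i. \<zeta>' i (\<tau> i))) =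
    (\<Sum>S\<in>Pow I. a S * b S * (\<Prod>i\<in>S. r i))"
  using assms(2-)
proof (induction I arbitrary: a b rule: finite_induct)
  case empty
  then show ?case by (simp add: mlin_def)
next
  case (insert i I)
  let ?a = "\<lambda>S. a (insert i S)" and ?b = "\<lambda>S. b (insert i S)"
  let ?A = "\<lambda>a \<tau>. mlin a I (\<lambda>j. \<zeta> j (\<tau> j))" and ?B = "\<lambda>b \<tau>. mlin b I (\<lambda>j. \<zeta>' j (\<tau> j))"
  have *: "(\<Sum>w\<in>UNIV. p w * ((x + \<zeta> i w * x') * (y + \<zeta>' i w * y'))) = x * y + r i * (x' * y')"
    for x x' y y'
  proof -
    have "(\<Sum>w\<in>UNIV. p w * ((x + \<zeta> i w * x') * (y + \<zeta>' i w * y'))) =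
        x * y * (\<Sum>w\<in>UNIV. p w) + x' * y * (\<Sum>w\<in>UNIV. p w * \<zeta> i w)
        + x * y' * (\<Sum>w\<in>UNIV. p w * \<zeta>' i w)
        + x' * y' * (\<Sum>w\<in>UNIV. p w * (\<zeta> i w * \<zeta>' i w))"
      unfolding sum_distrib_left sum.distrib[symmetric] by (intro sum.cong) (auto simp: algebra_simps)
    then show ?thesis using insert.prems by (simp add: prob_weight_sum[OF assms(1)])
  qed
  have **: "(\<Sum>S\<in>Pow I. ?a S * ?b S * prod r (insert i S)) =
      r i * (\<Sum>S\<in>Pow I. ?a S * ?b S * prod r S)"
    unfolding sum_distrib_left
  proof (intro sum.cong refl)
    fix S assume "S \<in> Pow I"
    then have "finite S" "i \<notin> S" using insert.hyps finite_subset by auto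
    then show "?a S * ?b S * prod r (insert i S) = r i * (?a S * ?b S * prod r S)" by simp
  qed
  have IH: "pexp p I (\<lambda>\<tau>. ?A a \<tau> * ?B b \<tau>) = (\<Sum>S\<in>Pow I. a S * b S * prod r S)" for a b
    using insert.IH insert.prems by simp
  show ?case
    using insert.hyps
    by (simp add: pexp_insert mlin_insert mlin_upd fun_upd_same * pexp_add pexp_cmult IH sum_Pow_insert ** del: fun_upd_apply)

qed

section \<open>Hypercontractivity and Lindeberg replacement\<close>

definition bonami_rv :: "('w::finite \<Rightarrow> real) \<Rightarrow> ('w \<Rightarrow> real) \<Rightarrow> bool" where
  "bonami_rv p z \<longleftrightarrow> (\<Sum>w\<in>UNIV. p w * z w) = 0 \<and> (\<Sum>w\<in>UNIV. p w * z w ^ 2) = 1 \<and>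
     (\<Sum>w\<in>UNIV. p w * z w ^ 3) = 0 \<and> (\<Sum>w\<in>UNIV. p w * z w ^ 4) \<le> 9"

text \<open>Cauchy-Schwarz, with the square root of the product weight shared between the two
  factors.\<close>

lemma pexp_mult_le:
  assumes p: "prob_weight p" "finite I"
    and "pexp p I (\<lambda>\<tau>. X \<tau> ^ 2) \<le> \<alpha> ^ 2" "pexp p I (\<lambda>\<tau>. Y \<tau> ^ 2) \<le> \<beta> ^ 2" "\<alpha> \<ge> 0" "\<beta> \<ge> 0"
  shows "pexp p I (\<lambda>\<tau>. X \<tau> * Y \<tau>) \<le> \<alpha> * \<beta>"
proof -
  let ?P = "\<lambda>\<tau>. \<Prod>i\<in>I. p (\<tau> i)"
  have P: "?P \<tau> \<ge> 0" for \<tau> using p(1) by (intro prod_nonneg) (auto simp: prob_weight_nonneg)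
  have "pexp p I (\<lambda>\<tau>. X \<tau> * Y \<tau>) =
     (\<Sum>\<tau>\<in>I \<rightarrow>\<^sub>E UNIV. (sqrt (?P \<tau>) * X \<tau>) * (sqrt (?P \<tau>) * Y \<tau>))"
    unfolding pexp_def using P by (intro sum.cong refl) (simp add: algebra_simps flip: real_sqrt_mult)
  then have "(pexp p I (\<lambda>\<tau>. X \<tau> * Y \<tau>))\<^sup>2 \<le>
      (\<Sum>\<tau>\<in>I \<rightarrow>\<^sub>E UNIV. (sqrt (?P \<tau>) * X \<tau>)\<^sup>2) * (\<Sum>\<tau>\<in>I \<rightarrow>\<^sub>E UNIV. (sqrt (?P \<tau>) * Y \<tau>)\<^sup>2)"
    by (simp only: Cauchy_Schwarz_ineq_sum)
  also have "\<dots> = pexp p I (\<lambda>\<tau>. X \<tau> ^ 2) * pexp p I (\<lambda>\<tau>. Y \<tau> ^ 2)"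
    unfolding pexp_def using P by (simp add: power_mult_distrib)
  also have "\<dots> \<le> \<alpha>\<^sup>2 * \<beta>\<^sup>2"
    using assms by (intro mult_mono pexp_nonneg) auto
  finally have "(pexp p I (\<lambda>\<tau>. X \<tau> * Y \<tau>))\<^sup>2 \<le> (\<alpha> * \<beta>)\<^sup>2" by (simp add: power_mult_distrib)
  then show ?thesis using assms by (meson mult_nonneg_nonneg power2_le_imp_le)
qed

text \<open>Split the polynomial as \<open>A + z B\<close>, where \<open>B\<close> has degree one
  less. The first and third moments of \<open>z\<close> vanish, so the fourth moment is at most that
  of \<open>A\<close>, plus \<open>6 A^2 B^2\<close>, plus \<open>9 B^4\<close>. The lower degree of
  \<open>B\<close> gains a factor 1/9, which exactly absorbs the 9, and by Cauchy-Schwarz the mixed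
  term becomes the cross term of \<open>(e + e')^2\<close>.\<close>

lemma bonami:
  fixes \<zeta> :: "'i \<Rightarrow> 'w::finite \<Rightarrow> real"
  assumes p: "prob_weight p" and "finite I"
    and "\<And>i. i \<in> I \<Longrightarrow> bonami_rv p (\<zeta> i)"
    and "\<And>S. S \<subseteq> I \<Longrightarrow> card S > d \<Longrightarrow> a S = 0"
  shows "pexp p I (\<lambda>\<tau>. mlin a I (\<lambda>i. \<zeta> i (\<tau> i)) ^ 4) \<le> 9 ^ d * (\<Sum>S\<in>Pow I. (a S)\<^sup>2)\<^sup>2"
  using assms(2-)
proof (induction I arbitrary: a d rule: finite_induct)
  case empty
  have "a {} ^ 4 \<le> 9 ^ d * a {} ^ 4" by (simp add: mult_le_cancel_right1)
  then show ?case by (simp add: mlin_def)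
next
  case (insert i I)
  let ?b = "\<lambda>S. a (insert i S)"
  let ?A = "\<lambda>a \<tau>. mlin a I (\<lambda>j. \<zeta> j (\<tau> j))"
  define e where "e = (\<Sum>S\<in>Pow I. (a S)\<^sup>2)"
  define e' where "e' = (\<Sum>S\<in>Pow I. (?b S)\<^sup>2)"
  have e: "e \<ge> 0" "e' \<ge> 0" unfolding e_def e'_def by (auto intro: sum_nonneg)
  have \<zeta>: "bonami_rv p (\<zeta> i)" using insert.prems by simp
  have *: "(\<Sum>w\<in>UNIV. p w * (x + \<zeta> i w * y) ^ 4) \<le> x ^ 4 + 6 * (x\<^sup>2 * y\<^sup>2) + 9 * y ^ 4" for x y
  proof -
    have "(\<Sum>w\<in>UNIV. p w * (x + \<zeta> i w * y) ^ 4) =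
        x ^ 4 * (\<Sum>w\<in>UNIV. p w) + 4 * x ^ 3 * y * (\<Sum>w\<in>UNIV. p w * \<zeta> i w)
        + 6 * (x\<^sup>2 * y\<^sup>2) * (\<Sum>w\<in>UNIV. p w * \<zeta> i w ^ 2)
        + 4 * x * y ^ 3 * (\<Sum>w\<in>UNIV. p w * \<zeta> i w ^ 3)
        + (\<Sum>w\<in>UNIV. p w * \<zeta> i w ^ 4) * y ^ 4"
      unfolding sum_distrib_left sum_distrib_right sum.distrib[symmetric]
      by (intro sum.cong refl) (simp add: power2_eq_square power3_eq_cube power4_eq_xxxx algebra_simps)
    also have "\<dots> \<le> x ^ 4 + 6 * (x\<^sup>2 * y\<^sup>2) + 9 * y ^ 4"
      using \<zeta> prob_weight_sum[OF p] by (simp add: bonami_rv_def mult_right_mono)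
    finally show ?thesis .
  qed
  have 1: "pexp p I (\<lambda>\<tau>. ?A a \<tau> ^ 4) \<le> 9 ^ d * e\<^sup>2"
    unfolding e_def using insert.prems by (intro insert.IH) auto
  \<comment> \<open>The bound is written \<open>9 ^ d / 9\<close> so as to include
    \<open>d = 0\<close>, where the factor of the new variable vanishes.\<close>
  have 2: "pexp p I (\<lambda>\<tau>. ?A ?b \<tau> ^ 4) \<le> 9 ^ d / 9 * e'\<^sup>2"
  proof (cases d)
    case 0
    have "?b S = 0" if "S \<subseteq> I" for S
    proof -
      have "finite S" using that insert.hyps finite_subset by auto
      then show ?thesis using insert.prems(2)[of "insert i S"] that 0 by (auto simp: card_gt_0_iff)
    qed
    then have "?A ?b \<tau> = 0" for \<tau> by (simp add: mlin_def)
    then show ?thesis by (simp add: pexp_def)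
  next
    case (Suc d')
    have "pexp p I (\<lambda>\<tau>. ?A ?b \<tau> ^ 4) \<le> 9 ^ d' * e'\<^sup>2"
      unfolding e'_def
    proof (rule insert.IH)
      show "?b S = 0" if "S \<subseteq> I" "d' < card S" for S
      proof -
        have "finite S" "i \<notin> S" using that insert.hyps finite_subset by auto
        then show ?thesis using insert.prems(2)[of "insert i S"] that Suc by auto
      qed
    qed (use insert.prems in auto)
    then show ?thesis using Suc by simp
  qed
  have 3: "pexp p I (\<lambda>\<tau>. (?A a \<tau>)\<^sup>2 * (?A ?b \<tau>)\<^sup>2) \<le> (3 ^ d * e) * (3 ^ d / 3 * e')"
  proof (rule pexp_mult_le[OF p insert.hyps(1)])
    have *: "(3 ^ d) ^ 2 = (9::real) ^ d" by (simp add: power2_eq_square flip: power_mult_distrib)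
    show "pexp p I (\<lambda>\<tau>. ((?A a \<tau>)\<^sup>2)\<^sup>2) \<le> (3 ^ d * e)\<^sup>2"
      "pexp p I (\<lambda>\<tau>. ((?A ?b \<tau>)\<^sup>2)\<^sup>2) \<le> (3 ^ d / 3 * e')\<^sup>2"
      using 1 2 by (simp_all add: power_mult_distrib power_divide *)
  qed (use e in auto)
  have **: "3 ^ d * 3 ^ d = (9::real) ^ d" by (simp flip: power_mult_distrib)
  have "pexp p (insert i I) (\<lambda>\<tau>. mlin a (insert i I) (\<lambda>i. \<zeta> i (\<tau> i)) ^ 4) \<le>
     pexp p I (\<lambda>\<tau>. ?A a \<tau> ^ 4 + 6 * ((?A a \<tau>)\<^sup>2 * (?A ?b \<tau>)\<^sup>2) + 9 * ?A ?b \<tau> ^ 4)"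
    using insert.hyps by (simp add: pexp_insert mlin_insert mlin_upd fun_upd_same pexp_mono[OF p] * del: fun_upd_apply)
  also have "\<dots> \<le> 9 ^ d * e\<^sup>2 + 6 * ((3 ^ d * e) * (3 ^ d / 3 * e')) + 9 * (9 ^ d / 9 * e'\<^sup>2)"
    unfolding pexp_add pexp_cmult using 1 2 3 by linarith
  also have "\<dots> = 9 ^ d * (e + e')\<^sup>2"
    unfolding **[symmetric] by (simp add: power2_eq_square algebra_simps)
  also have "e + e' = (\<Sum>S\<in>Pow (insert i I). (a S)\<^sup>2)"
    unfolding e_def e'_def sum_Pow_insert[OF insert.hyps] ..
  finally show ?case .
qed

text \<open>The influence of coordinate \<open>i\<close>: the squared L2 norm of the partial
  derivative of the polynomial in that direction.\<close>

definition coord_weight :: "'i set \<Rightarrow> ('i set \<Rightarrow> real) \<Rightarrow> 'i \<Rightarrow> real" where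
  "coord_weight I a i = (\<Sum>S | S \<subseteq> I \<and> i \<in> S. (a S)\<^sup>2)"

lemma coord_weight_insert:
  assumes "finite I" "i \<notin> I"
  shows "coord_weight (insert i I) a i = (\<Sum>S\<in>Pow I. (a (insert i S))\<^sup>2)"
proof -
  have "{S. S \<subseteq> insert i I \<and> i \<in> S} = insert i ` Pow I"
  proof (intro equalityI subsetI)
    fix S assume "S \<in> {S. S \<subseteq> insert i I \<and> i \<in> S}"
    then have "S = insert i (S - {i})" "S - {i} \<in> Pow I" by auto
    then show "S \<in> insert i ` Pow I" by blast
  qed auto
  then show ?thesis
    using assms by (simp add: coord_weight_def sum.reindex[OF inj_on_insert_Pow])
qed

text \<open>With the other variables fixed, the polynomial is \<open>A + z B\<close> with
  \<open>A\<close> and \<open>B\<close> free of variable \<open>i\<close>, so the exchange costs at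
  most \<open>K B^4\<close>. Bonami's lemma bounds the mean of \<open>B^4\<close> by the squared
  influence of \<open>i\<close>.\<close>

lemma lindeberg_step:
  fixes \<zeta> \<xi> :: "'i \<Rightarrow> 'w::finite \<Rightarrow> real"
  assumes p: "prob_weight p" and I: "finite I" "i \<in> I"
    and \<zeta>: "\<And>i. i \<in> I \<Longrightarrow> bonami_rv p (\<zeta> i)"
    and d: "\<And>S. S \<subseteq> I \<Longrightarrow> card S > d \<Longrightarrow> a S = 0"
    and eq: "\<And>j. j \<in> I \<Longrightarrow> j \<noteq> i \<Longrightarrow> \<zeta> j = \<xi> j"
    and \<psi>: "\<And>x y. \<bar>(\<Sum>w\<in>UNIV. p w * \<psi> (x + \<zeta> i w * y)) - (\<Sum>w\<in>UNIV. p w * \<psi> (x + \<xi> i w * y))\<bar>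
        \<le> K * y ^ 4"
  shows "\<bar>pexp p I (\<lambda>\<tau>. \<psi> (mlin a I (\<lambda>j. \<zeta> j (\<tau> j)))) - pexp p I (\<lambda>\<tau>. \<psi> (mlin a I (\<lambda>j. \<xi> j (\<tau> j))))\<bar>
     \<le> K * 9 ^ d * (coord_weight I a i)\<^sup>2"
proof -
  define J where "J = I - {i}"
  have J: "finite J" "i \<notin> J" and IJ: "I = insert i J" using I by (auto simp: J_def)
  let ?b = "\<lambda>S. a (insert i S)"
  let ?A = "\<lambda>a \<tau>. mlin a J (\<lambda>j. \<zeta> j (\<tau> j))"
  have \<xi>: "mlin a J (\<lambda>j. \<xi> j (\<tau> j)) = ?A a \<tau>" for a \<tau>
    using eq by (intro mlin_cong) (auto simp: J_def)
  have \<xi>': "mlin a J (\<lambda>j. \<xi> j ((\<tau>(i := w)) j)) = ?A a \<tau>" for a \<tau> w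
    using \<xi> mlin_upd[OF J(2)] by metis
  \<comment> \<open>The assumption on \<open>\<psi>\<close> at \<open>x = 0\<close>,
    \<open>y = 1\<close> forces this sign.\<close>
  have K: "K \<ge> 0" using order_trans[OF abs_ge_zero \<psi>[of 0 1]] by simp
  have "\<bar>pexp p I (\<lambda>\<tau>. \<psi> (mlin a I (\<lambda>j. \<zeta> j (\<tau> j)))) - pexp p I (\<lambda>\<tau>. \<psi> (mlin a I (\<lambda>j. \<xi> j (\<tau> j))))\<bar>
     = \<bar>pexp p J (\<lambda>\<tau>. (\<Sum>w\<in>UNIV. p w * \<psi> (?A a \<tau> + \<zeta> i w * ?A ?b \<tau>)) -
        (\<Sum>w\<in>UNIV. p w * \<psi> (?A a \<tau> + \<xi> i w * ?A ?b \<tau>)))\<bar>"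
    unfolding IJ using J by (simp add: pexp_insert mlin_insert mlin_upd fun_upd_same \<xi> \<xi>' pexp_diff fun_upd_same del: fun_upd_apply)
  also have "\<dots> \<le> pexp p J (\<lambda>\<tau>. K * ?A ?b \<tau> ^ 4)"
    by (rule order_trans[OF abs_pexp_le[OF p]], rule pexp_mono[OF p], rule \<psi>)
  also have "\<dots> \<le> K * (9 ^ d * (\<Sum>S\<in>Pow J. (?b S)\<^sup>2)\<^sup>2)"
    unfolding pexp_cmult
  proof (intro mult_left_mono K bonami p J)
    show "bonami_rv p (\<zeta> i)" if "i \<in> J" for i using that \<zeta> by (simp add: J_def)
    show "a (insert i S) = 0" if "S \<subseteq> J" "d < card S" for S
    proof -
      have "finite S" "i \<notin> S" using that J finite_subset by auto
      then show ?thesis using d[of "insert i S"] that by (simp add: IJ subset_insertI2)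
    qed
  qed
  also have "\<dots> = K * 9 ^ d * (coord_weight I a i)\<^sup>2"
    unfolding IJ coord_weight_insert[OF J] by simp
  finally show ?thesis .
qed

text \<open>Telescoping over the hybrids \<open>?h B\<close>, in which the variables in
  \<open>B\<close> have already been exchanged. The error involves squares of influences, hence is
  small when each influence is small.\<close>

lemma lindeberg:
  fixes \<zeta> \<xi> :: "'i \<Rightarrow> 'w::finite \<Rightarrow> real"
  assumes p: "prob_weight p" and I: "finite I"
    and rv: "\<And>i. i \<in> I \<Longrightarrow> bonami_rv p (\<zeta> i)" "\<And>i. i \<in> I \<Longrightarrow> bonami_rv p (\<xi> i)"
    and d: "\<And>S. S \<subseteq> I \<Longrightarrow> card S > d \<Longrightarrow> a S = 0"
    and \<psi>: "\<And>i x y. i \<in> I \<Longrightarrow>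
      \<bar>(\<Sum>w\<in>UNIV. p w * \<psi> (x + \<zeta> i w * y)) - (\<Sum>w\<in>UNIV. p w * \<psi> (x + \<xi> i w * y))\<bar> \<le> K * y ^ 4"
  shows "\<bar>pexp p I (\<lambda>\<tau>. \<psi> (mlin a I (\<lambda>j. \<zeta> j (\<tau> j)))) - pexp p I (\<lambda>\<tau>. \<psi> (mlin a I (\<lambda>j. \<xi> j (\<tau> j))))\<bar>
     \<le> K * 9 ^ d * (\<Sum>i\<in>I. (coord_weight I a i)\<^sup>2)"
proof -
  let ?h = "\<lambda>B j. if j \<in> B then \<xi> j else \<zeta> j"
  let ?E = "\<lambda>z. pexp p I (\<lambda>\<tau>. \<psi> (mlin a I (\<lambda>j. z j (\<tau> j))))"
  have "\<bar>?E \<zeta> - ?E (?h B)\<bar> \<le> K * 9 ^ d * (\<Sum>i\<in>B. (coord_weight I a i)\<^sup>2)" if "B \<subseteq> I" for B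
    using finite_subset[OF that I] that
  proof (induction B rule: finite_induct)
    case empty
    then show ?case by simp
  next
    case (insert i B)
    have "\<bar>?E (?h B) - ?E (?h (insert i B))\<bar> \<le> K * 9 ^ d * (coord_weight I a i)\<^sup>2"
    proof (rule lindeberg_step[OF p I])
      show "i \<in> I" using insert by simp
      show "bonami_rv p (?h B j)" if "j \<in> I" for j using rv that by simp
      show "?h B j = ?h (insert i B) j" if "j \<noteq> i" for j using that by simp
      show "\<bar>(\<Sum>w\<in>UNIV. p w * \<psi> (x + ?h B i w * y)) -
          (\<Sum>w\<in>UNIV. p w * \<psi> (x + ?h (insert i B) i w * y))\<bar> \<le> K * y ^ 4" for x y
        using \<psi>[of i x y] insert by simp
    qed (use d in auto)
    then show ?case using insert by (simp add: ring_distribs)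
  qed
  from this[of I] have "\<bar>?E \<zeta> - ?E (?h I)\<bar> \<le> K * 9 ^ d * (\<Sum>i\<in>I. (coord_weight I a i)\<^sup>2)" by simp
  moreover have "?E (?h I) = ?E \<xi>"
    by (intro pexp_cong arg_cong[of _ _ \<psi>] mlin_cong) auto
  ultimately show ?thesis by simp
qed

section \<open>The discrete cube\<close>

lemma UNIV_bit: "(UNIV :: bit set) = {0, 1}"
  by (metis (mono_tags) UNIV_eq_I bit_not_zero_iff insert_iff)

instance bit :: finite
  by standard (simp add: UNIV_bit)

lemma sum_bit: "(\<Sum>b\<in>UNIV. f b) = f (0 :: bit) + f 1"
  by (simp add: UNIV_bit)

lemma sum_bit_pair:
  "(\<Sum>w\<in>UNIV. f w) = f (0 :: bit, 0 :: bit) + f (0, 1) + (f (1, 0) + f (1, 1))"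
  by (simp add: UNIV_Times_UNIV[symmetric] sum.cartesian_product' sum_bit del: UNIV_Times_UNIV)

definition bsign :: "bit \<Rightarrow> real" where
  "bsign b = (if b = 0 then 1 else - 1)"

lemma bsign_simps [simp]: "bsign 0 = 1" "bsign 1 = - 1"
  by (simp_all add: bsign_def)

definition coin :: "bit \<Rightarrow> real" where
  "coin b = 1 / 2"

lemma prob_weight_coin: "prob_weight coin"
  by (simp add: prob_weight_def coin_def UNIV_bit)

text \<open>The joint law of a uniform bit and of a copy that is flipped with probability \<open>t\<close>.\<close>

definition flip_pair :: "real \<Rightarrow> bit \<times> bit \<Rightarrow> real" where
  "flip_pair t = (\<lambda>(a, b). if a = b then (1 - t) / 2 else t / 2)"

lemma flip_pair_simps [simp]:
  "flip_pair t (0, 0) = (1 - t) / 2" "flip_pair t (1, 1) = (1 - t) / 2"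
  "flip_pair t (0, 1) = t / 2" "flip_pair t (1, 0) = t / 2"
  by (simp_all add: flip_pair_def)

lemma prob_weight_flip_pair: "0 \<le> t \<Longrightarrow> t \<le> 1 \<Longrightarrow> prob_weight (flip_pair t)"
  by (auto simp: prob_weight_def sum_bit_pair flip_pair_def split: prod.splits)

text \<open>Restriction to \<open>I\<close> puts the projections into
  \<open>I \<rightarrow>\<^sub>E UNIV\<close>, the domain on which functions are expanded.\<close>

abbreviation fst_pt :: "'i set \<Rightarrow> ('i \<Rightarrow> 'a \<times> 'b) \<Rightarrow> 'i \<Rightarrow> 'a" where
  "fst_pt I w \<equiv> \<lambda>i\<in>I. fst (w i)"

abbreviation snd_pt :: "'i set \<Rightarrow> ('i \<Rightarrow> 'a \<times> 'b) \<Rightarrow> 'i \<Rightarrow> 'b" where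
  "snd_pt I w \<equiv> \<lambda>i\<in>I. snd (w i)"

lemma pexp_fst_pt: "finite I \<Longrightarrow> pexp (flip_pair t) I (\<lambda>w. F (fst_pt I w)) = pexp coin I F"
proof (rule pexp_image)
  fix b :: bit
  have "{a. fst a = b} = {(b, 0), (b, 1 :: bit)}" using UNIV_bit by (auto simp: set_eq_iff)
  then show "coin b = (\<Sum>a | fst a = b. flip_pair t a)"
    by (cases b) (auto simp: coin_def field_simps)
qed

lemma pexp_snd_pt: "finite I \<Longrightarrow> pexp (flip_pair t) I (\<lambda>w. F (snd_pt I w)) = pexp coin I F"
proof (rule pexp_image)
  fix b :: bit
  have "{a. snd a = b} = {(0, b), (1 :: bit, b)}" using UNIV_bit by (auto simp: set_eq_iff)
  then show "coin b = (\<Sum>a | snd a = b. flip_pair t a)"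
    by (cases b) (auto simp: coin_def field_simps)
qed

text \<open>The even and odd parts of \<open>f\<close> in coordinate \<open>i\<close> depend on the
  other coordinates only. The even part supplies the coefficients of the sets without
  \<open>i\<close>, the odd part those of the sets with \<open>i\<close>.\<close>

lemma walsh_expansion:
  fixes f :: "('i \<Rightarrow> bit) \<Rightarrow> real"
  assumes "finite I"
  shows "\<exists>a. \<forall>x\<in>I \<rightarrow>\<^sub>E UNIV. f x = mlin a I (\<lambda>i. bsign (x i))"
  using assms
proof (induction I arbitrary: f rule: finite_induct)
  case empty
  then show ?case by (auto simp: mlin_def intro!: exI[of _ "\<lambda>_. f (\<lambda>_. undefined)"])
next
  case (insert i I)
  obtain a where a: "\<And>x. x \<in> I \<rightarrow>\<^sub>E UNIV \<Longrightarrow>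
      (f (x(i := 0)) + f (x(i := 1))) / 2 = mlin a I (\<lambda>i. bsign (x i))"
    using insert.IH[of "\<lambda>x. (f (x(i := 0)) + f (x(i := 1))) / 2"] by blast
  obtain b where b: "\<And>x. x \<in> I \<rightarrow>\<^sub>E UNIV \<Longrightarrow>
      (f (x(i := 0)) - f (x(i := 1))) / 2 = mlin b I (\<lambda>i. bsign (x i))"
    using insert.IH[of "\<lambda>x. (f (x(i := 0)) - f (x(i := 1))) / 2"] by blast
  define c where "c = (\<lambda>S. if i \<in> S then b (S - {i}) else a S)"
  have ca: "mlin c I z = mlin a I z" and cb: "mlin (\<lambda>S. c (insert i S)) I z = mlin b I z" for z
  proof -
    show "mlin c I z = mlin a I z"
      using insert.hyps unfolding mlin_def c_def by (intro sum.cong) auto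
    have "insert i S - {i} = S" if "S \<in> Pow I" for S using that insert.hyps by auto
    then show "mlin (\<lambda>S. c (insert i S)) I z = mlin b I z"
      unfolding mlin_def c_def by (intro sum.cong) auto
  qed
  have "f x = mlin c (insert i I) (\<lambda>i. bsign (x i))" if x: "x \<in> insert i I \<rightarrow>\<^sub>E UNIV" for x
  proof -
    define y where "y = x(i := undefined)"
    have y: "y \<in> I \<rightarrow>\<^sub>E UNIV" using x insert.hyps by (auto simp: y_def PiE_iff extensional_def)
    have xy: "mlin a I (\<lambda>i. bsign (x i)) = mlin a I (\<lambda>i. bsign (y i))" for a
      using insert.hyps by (intro mlin_cong) (auto simp: y_def)
    have "x = y(i := x i)" by (simp add: y_def)
    then have "f x = f (y(i := x i))" by simp
    also have "\<dots> = (f (y(i := 0)) + f (y(i := 1))) / 2 + bsign (x i) * ((f (y(i := 0)) - f (y(i := 1))) / 2)"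
      by (cases "x i") (auto simp: field_simps)
    also have "\<dots> = mlin c (insert i I) (\<lambda>i. bsign (x i))"
      unfolding mlin_insert[OF insert.hyps] ca cb a[OF y] b[OF y] xy ..
    finally show ?thesis .
  qed
  then show ?case by blast
qed

lemma pexp_coin_mlin_mult:
  assumes "finite I"
  shows "pexp coin I (\<lambda>x. mlin a I (\<lambda>i. bsign (x i)) * mlin b I (\<lambda>i. bsign (x i))) = (\<Sum>S\<in>Pow I. a S * b S)"
  using pexp_mlin_mult[OF prob_weight_coin assms, where \<zeta> = "\<lambda>_. bsign" and \<zeta>' = "\<lambda>_. bsign" and r = "\<lambda>_. 1"]
  by (simp add: sum_bit coin_def)

lemma pexp_coin_mlin_square:
  "finite I \<Longrightarrow> pexp coin I (\<lambda>x. (mlin a I (\<lambda>i. bsign (x i)))\<^sup>2) = (\<Sum>S\<in>Pow I. (a S)\<^sup>2)"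
  using pexp_coin_mlin_mult[of I a a] by (simp add: power2_eq_square)

text \<open>Orthogonality against a single monomial, itself a polynomial with one nonzero
  coefficient. It recovers the coefficients from the function, so symmetries of the function pass to
  them.\<close>

lemma walsh_coeff:
  assumes "finite I" "S \<subseteq> I"
  shows "a S = pexp coin I (\<lambda>x. mlin a I (\<lambda>i. bsign (x i)) * (\<Prod>i\<in>S. bsign (x i)))"
proof -
  have "(\<Prod>i\<in>S. z i) = mlin (\<lambda>T. if T = S then 1 else 0) I z" for z :: "'a \<Rightarrow> real"
    using assms by (simp add: mlin_def if_distrib[of "\<lambda>u. u * _"] sum.delta cong: if_cong)
  then have "pexp coin I (\<lambda>x. mlin a I (\<lambda>i. bsign (x i)) * (\<Prod>i\<in>S. bsign (x i))) =
      (\<Sum>T\<in>Pow I. a T * (if T = S then 1 else 0))"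
    by (simp add: pexp_coin_mlin_mult[OF assms(1)])
  also have "\<dots> = a S"
    using assms by (simp add: if_distrib[of "\<lambda>u. _ * u"] sum.delta cong: if_cong)
  finally show ?thesis ..
qed

section \<open>Symmetry, influences and energies\<close>

lemma pexp_permute:
  fixes g :: "'i \<Rightarrow> 'i" and p :: "'w::finite \<Rightarrow> real"
  assumes "g permutes I"
  shows "pexp p I (\<lambda>x. F (x \<circ> g)) = pexp p I F"
proof -
  have *: "x \<circ> h \<in> I \<rightarrow>\<^sub>E UNIV" if "x \<in> I \<rightarrow>\<^sub>E UNIV" "h permutes I" for x :: "'i \<Rightarrow> 'w" and h
    using that by (auto simp: PiE_iff extensional_def permutes_not_in)
  have bij: "bij_betw (\<lambda>x. x \<circ> g) (I \<rightarrow>\<^sub>E (UNIV :: 'w set)) (I \<rightarrow>\<^sub>E UNIV)"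
    by (rule bij_betw_byWitness[where f' = "\<lambda>x. x \<circ> inv' g"])
      (use assms * permutes_inv[OF assms] in \<open>auto simp: o_assoc[symmetric] permutes_inv_o\<close>)
  have "(\<Prod>i\<in>I. p (x i)) = (\<Prod>i\<in>I. p ((x \<circ> g) i))" for x
    using prod.permute[OF assms, of "\<lambda>i. p (x i)"] by (simp add: o_def)
  then show ?thesis
    unfolding pexp_def
    using sum.reindex_bij_betw[OF bij, of "\<lambda>x. (\<Prod>i\<in>I. p (x i)) * F x"] by simp
qed

text \<open>Invariance under a transitive group without naming the group. The values have arbitrary
  type, so that the notion covers maps into L1 as well as their sections and level cuts.\<close>

definition transitively_symmetric :: "'i set \<Rightarrow> (('i \<Rightarrow> 'w) \<Rightarrow> 'a) \<Rightarrow> bool" where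
  "transitively_symmetric I f \<longleftrightarrow> (\<forall>i\<in>I. \<forall>j\<in>I. \<exists>h. h permutes I \<and> h i = j \<and>
     (\<forall>x\<in>I \<rightarrow>\<^sub>E UNIV. f (x \<circ> h) = f x))"

lemma coord_weight_symmetric:
  assumes I: "finite I" and sym: "transitively_symmetric I f"
    and f: "\<And>x. x \<in> I \<rightarrow>\<^sub>E UNIV \<Longrightarrow> f x = mlin a I (\<lambda>i. bsign (x i))"
    and ij: "i \<in> I" "j \<in> I"
  shows "coord_weight I (\<lambda>S. if card S \<le> d then a S else 0) i =
    coord_weight I (\<lambda>S. if card S \<le> d then a S else 0) j"
proof -
  obtain h where h: "h permutes I" "h i = j" "\<And>x. x \<in> I \<rightarrow>\<^sub>E UNIV \<Longrightarrow> f (x \<circ> h) = f x"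
    using bspec[OF bspec[OF sym[unfolded transitively_symmetric_def] ij(1)] ij(2)] by blast
  have inj: "inj_on h S" for S using permutes_inj_on[OF h(1)] .
  have coeff: "a S = pexp coin I (\<lambda>x. f x * (\<Prod>i\<in>S. bsign (x i)))" if "S \<subseteq> I" for S
    unfolding walsh_coeff[OF I that, of a] using f by (intro pexp_cong) simp
  have a: "a (h ` S) = a S" if "S \<subseteq> I" for S
  proof -
    have hS: "h ` S \<subseteq> I" using that permutes_image[OF h(1)] by blast
    have "a S = pexp coin I (\<lambda>x. f (x \<circ> h) * (\<Prod>i\<in>S. bsign ((x \<circ> h) i)))"
      unfolding coeff[OF that] by (rule pexp_permute[OF h(1), symmetric])
    also have "\<dots> = a (h ` S)"
      unfolding coeff[OF hS] using h(3) by (intro pexp_cong) (simp add: prod.reindex[OF inj] o_def)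
    finally show ?thesis by simp
  qed
  let ?b = "\<lambda>S. if card S \<le> d then a S else 0"
  have bij: "bij_betw (image h) {S. S \<subseteq> I \<and> i \<in> S} {S. S \<subseteq> I \<and> j \<in> S}"
  proof (rule bij_betw_byWitness[where f' = "image (inv' h)"])
    have im: "h ` S \<subseteq> I" "inv' h ` S \<subseteq> I" if "S \<subseteq> I" for S
      using that permutes_image[OF h(1)] permutes_image[OF permutes_inv[OF h(1)]] by blast+
    have "inv' h j = i" using h(1,2) permutes_inverses(2) by metis
    then have mem: "i \<in> inv' h ` S" if "j \<in> S" for S using that by (metis imageI)
    show "image h ` {S. S \<subseteq> I \<and> i \<in> S} \<subseteq> {S. S \<subseteq> I \<and> j \<in> S}"
    proof
      fix T assume "T \<in> image h ` {S. S \<subseteq> I \<and> i \<in> S}"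
      then obtain S where S: "T = h ` S" "S \<subseteq> I" "i \<in> S" by blast
      then show "T \<in> {S. S \<subseteq> I \<and> j \<in> S}"
        using im(1)[OF S(2)] imageI[OF S(3), of h] h(2) by simp
    qed
    show "image (inv' h) ` {S. S \<subseteq> I \<and> j \<in> S} \<subseteq> {S. S \<subseteq> I \<and> i \<in> S}"
    proof
      fix T assume "T \<in> image (inv' h) ` {S. S \<subseteq> I \<and> j \<in> S}"
      then obtain S where S: "T = inv' h ` S" "S \<subseteq> I" "j \<in> S" by blast
      then show "T \<in> {S. S \<subseteq> I \<and> i \<in> S}"
        using im(2)[OF S(2)] mem[OF S(3)] by simp
    qed
  qed (simp_all add: image_comp permutes_inv_o[OF h(1)])
  have "coord_weight I ?b i = (\<Sum>S | S \<subseteq> I \<and> i \<in> S. (?b (h ` S))\<^sup>2)"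
    unfolding coord_weight_def by (intro sum.cong refl) (simp add: a card_image[OF inj])
  also have "\<dots> = coord_weight I ?b j"
    unfolding coord_weight_def by (rule sum.reindex_bij_betw[OF bij])
  finally show ?thesis .
qed

text \<open>Double counting of the pairs \<open>i \<in> S\<close>; the common value is the total
  influence.\<close>

lemma sum_coord_weight:
  fixes a :: "'i set \<Rightarrow> real"
  assumes "finite I"
  shows "(\<Sum>i\<in>I. coord_weight I a i) = (\<Sum>S\<in>Pow I. real (card S) * (a S)\<^sup>2)"
proof -
  have "(\<Sum>i\<in>I. coord_weight I a i) = (\<Sum>i\<in>I. \<Sum>S\<in>Pow I. if i \<in> S then (a S)\<^sup>2 else 0)"
    unfolding coord_weight_def using assms
    by (intro sum.cong refl sum.mono_neutral_cong_left) auto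
  also have "\<dots> = (\<Sum>S\<in>Pow I. \<Sum>i\<in>I. if i \<in> S then (a S)\<^sup>2 else 0)" by (rule sum.swap)
  also have "\<dots> = (\<Sum>S\<in>Pow I. real (card S) * (a S)\<^sup>2)"
  proof (intro sum.cong refl)
    fix S assume "S \<in> Pow I"
    then have "I \<inter> S = S" by auto
    then show "(\<Sum>i\<in>I. if i \<in> S then (a S)\<^sup>2 else 0) = real (card S) * (a S)\<^sup>2"
      using assms by (simp add: sum.If_cases)
  qed
  finally show ?thesis .
qed

text \<open>The two signs of a pair have variance 1 and covariance \<open>1 - 2 * t\<close>, so the
  two copies of the monomial of \<open>S\<close> have correlation
  \<open>(1 - 2 * t) ^ card S\<close>.\<close>

lemma noise_energy:
  assumes t: "0 \<le> t" "t \<le> 1" and I: "finite I"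
  shows "pexp (flip_pair t) I (\<lambda>w. (mlin a I (\<lambda>i. bsign (fst (w i))) - mlin a I (\<lambda>i. bsign (snd (w i))))\<^sup>2) =
    2 * (\<Sum>S\<in>Pow I. (a S)\<^sup>2 * (1 - (1 - 2 * t) ^ card S))"
proof -
  let ?x = "\<lambda>w. mlin a I (\<lambda>i. bsign (fst (w i)))" and ?y = "\<lambda>w. mlin a I (\<lambda>i. bsign (snd (w i)))"
  note p = prob_weight_flip_pair[OF t]
  have xx: "pexp (flip_pair t) I (\<lambda>w. ?x w * ?x w) = (\<Sum>S\<in>Pow I. a S * a S * (\<Prod>i\<in>S. 1))"
    by (rule pexp_mlin_mult[OF p I, where \<zeta> = "\<lambda>_ w. bsign (fst w)" and \<zeta>' = "\<lambda>_ w. bsign (fst w)"])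
      (simp_all add: sum_bit_pair field_simps)
  have yy: "pexp (flip_pair t) I (\<lambda>w. ?y w * ?y w) = (\<Sum>S\<in>Pow I. a S * a S * (\<Prod>i\<in>S. 1))"
    by (rule pexp_mlin_mult[OF p I, where \<zeta> = "\<lambda>_ w. bsign (snd w)" and \<zeta>' = "\<lambda>_ w. bsign (snd w)"])
      (simp_all add: sum_bit_pair field_simps)
  have xy: "pexp (flip_pair t) I (\<lambda>w. ?x w * ?y w) = (\<Sum>S\<in>Pow I. a S * a S * (\<Prod>i\<in>S. 1 - 2 * t))"
    by (rule pexp_mlin_mult[OF p I, where \<zeta> = "\<lambda>_ w. bsign (fst w)" and \<zeta>' = "\<lambda>_ w. bsign (snd w)"])
      (simp_all add: sum_bit_pair field_simps)
  have "(\<lambda>w. (?x w - ?y w)\<^sup>2) = (\<lambda>w. ?x w * ?x w + ?y w * ?y w - 2 * (?x w * ?y w))"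
    by (simp add: power2_eq_square algebra_simps)
  then show ?thesis
    by (simp add: pexp_diff pexp_add pexp_cmult xx yy xy right_diff_distrib sum_subtractf power2_eq_square)
qed

text \<open>Rotating a pair of independent signs: unlike the cube itself, these variables carry a path
  from \<open>u\<close> to \<open>v\<close> whose covariances are those of a planar rotation.\<close>

definition rot :: "real \<Rightarrow> bit \<times> bit \<Rightarrow> real" where
  "rot \<alpha> w = cos \<alpha> * bsign (fst w) + sin \<alpha> * bsign (snd w)"

text \<open>The four equally likely sign patterns come in opposite pairs, so odd moments of
  \<open>rot \<alpha>\<close> vanish.\<close>

lemma sum_rot:
  "(\<Sum>w\<in>UNIV. flip_pair (1/2) w * F (rot \<alpha> w)) =
    (F (cos \<alpha> + sin \<alpha>) + F (- (cos \<alpha> + sin \<alpha>)) + F (cos \<alpha> - sin \<alpha>) + F (- (cos \<alpha> - sin \<alpha>))) / 4"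
  by (simp add: sum_bit_pair rot_def)

lemma sum_fourth_powers_le:
  fixes c s :: real
  assumes "c\<^sup>2 + s\<^sup>2 = 1"
  shows "(c + s) ^ 4 + (c - s) ^ 4 \<le> 4"
proof -
  have "(c + s) ^ 4 + (c - s) ^ 4 = 4 * (c\<^sup>2 + s\<^sup>2)\<^sup>2 - 2 * (c\<^sup>2 - s\<^sup>2)\<^sup>2" by algebra
  then show ?thesis using assms by simp
qed

text \<open>The values are \<open>x\<close>, \<open>- x\<close>, \<open>y\<close>,
  \<open>- y\<close> with \<open>x^2 + y^2 = 2\<close>. The fourth moment is the average of
  \<open>x^4\<close> and \<open>y^4\<close>, which is at most 2.\<close>

lemma bonami_rv_rot: "bonami_rv (flip_pair (1/2)) (rot \<alpha>)"
proof -
  define x y where "x = cos \<alpha> + sin \<alpha>" and "y = cos \<alpha> - sin \<alpha>"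
  have avg: "(\<Sum>w\<in>UNIV. flip_pair (1/2) w * F (rot \<alpha> w)) = (F x + F (- x) + F y + F (- y)) / 4" for F
    unfolding x_def y_def by (rule sum_rot)
  have "x\<^sup>2 + y\<^sup>2 = 2 * ((cos \<alpha>)\<^sup>2 + (sin \<alpha>)\<^sup>2)" unfolding x_def y_def by algebra
  then have "x\<^sup>2 + y\<^sup>2 = 2" by simp
  moreover have "x ^ 4 + y ^ 4 \<le> 4" unfolding x_def y_def by (rule sum_fourth_powers_le) simp
  ultimately show ?thesis
    using avg[of "\<lambda>x. x"] avg[of "\<lambda>x. x ^ 2"] avg[of "\<lambda>x. x ^ 3"] avg[of "\<lambda>x. x ^ 4"]
    by (simp add: bonami_rv_def)
qed

text \<open>The covariance of \<open>rot \<alpha>\<close> and \<open>rot \<beta>\<close> is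
  \<open>cos (\<alpha> - \<beta>)\<close>. Hence a rotation by an angle has the same energy as noise
  with \<open>1 - 2 * t\<close> equal to its cosine, which links the path to the noise.\<close>

lemma rot_energy:
  assumes I: "finite I"
  shows "pexp (flip_pair (1/2)) I (\<lambda>w. (mlin a I (\<lambda>i. rot \<alpha> (w i)) - mlin a I (\<lambda>i. rot \<beta> (w i)))\<^sup>2) =
    2 * (\<Sum>S\<in>Pow I. (a S)\<^sup>2 * (1 - cos (\<alpha> - \<beta>) ^ card S))"
    and "pexp (flip_pair (1/2)) I (\<lambda>w. (mlin a I (\<lambda>i. rot \<alpha> (w i)))\<^sup>2) = (\<Sum>S\<in>Pow I. (a S)\<^sup>2)"
proof -
  let ?z = "\<lambda>\<alpha> w. mlin a I (\<lambda>i. rot \<alpha> (w i))"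
  have *: "pexp (flip_pair (1/2)) I (\<lambda>w. ?z \<alpha> w * ?z \<beta> w) =
      (\<Sum>S\<in>Pow I. a S * a S * (\<Prod>i\<in>S. cos (\<alpha> - \<beta>)))" for \<alpha> \<beta>
    by (rule pexp_mlin_mult[OF prob_weight_flip_pair I, where \<zeta> = "\<lambda>_. rot \<alpha>" and \<zeta>' = "\<lambda>_. rot \<beta>"])
      (simp_all add: sum_bit_pair rot_def cos_diff algebra_simps)
  have "(\<lambda>w. (?z \<alpha> w - ?z \<beta> w)\<^sup>2) = (\<lambda>w. ?z \<alpha> w * ?z \<alpha> w + ?z \<beta> w * ?z \<beta> w - 2 * (?z \<alpha> w * ?z \<beta> w))"
    by (simp add: power2_eq_square algebra_simps)
  then show "pexp (flip_pair (1/2)) I (\<lambda>w. (?z \<alpha> w - ?z \<beta> w)\<^sup>2) =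
    2 * (\<Sum>S\<in>Pow I. (a S)\<^sup>2 * (1 - cos (\<alpha> - \<beta>) ^ card S))"
    by (simp add: pexp_diff pexp_add pexp_cmult * right_diff_distrib sum_subtractf power2_eq_square)
  show "pexp (flip_pair (1/2)) I (\<lambda>w. (?z \<alpha> w)\<^sup>2) = (\<Sum>S\<in>Pow I. (a S)\<^sup>2)"
    using *[of \<alpha> \<alpha>] by (simp add: power2_eq_square)
qed

section \<open>Noise sensitivity of transitively symmetric Boolean functions\<close>

text \<open>A bounded rational function, so that a global fourth-order Taylor estimate reduces to
  algebra.\<close>

definition psi :: "real \<Rightarrow> real" where
  "psi x = 1 / (1 + x\<^sup>2)"

text \<open>The coefficient of \<open>h^2\<close> is the second derivative of \<open>psi\<close>.
  Over the common denominator \<open>w ^ 3 * D\<close> the remainder is exactly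
  \<open>- 2 * q^2 * N\<close>, where \<open>q^2 = h^4\<close>; what is left is to bound the ratio
  of \<open>N\<close> to the denominator by 13.\<close>

lemma psi_second_difference:
  "\<bar>psi (x + h) + psi (x - h) - 2 * psi x - h\<^sup>2 * ((6 * x\<^sup>2 - 2) / (1 + x\<^sup>2) ^ 3)\<bar> \<le> 26 * h ^ 4"
proof -
  define p q w where "p = x\<^sup>2" and "q = h\<^sup>2" and "w = 1 + p"
  define D where "D = (1 + (x + h)\<^sup>2) * (1 + (x - h)\<^sup>2)"
  define N where "N = w\<^sup>2 + (3 * p - 1) * (2 - 2 * p + q)"
  have pq: "p \<ge> 0" "q \<ge> 0" "w \<ge> 1" by (auto simp: p_def q_def w_def)
  have D1: "D \<ge> 1"
    unfolding D_def using mult_mono[of 1 "1 + (x + h)\<^sup>2" 1 "1 + (x - h)\<^sup>2"] by simp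
  have D: "D = w\<^sup>2 + q * (2 - 2 * p) + q\<^sup>2" unfolding D_def w_def p_def q_def by algebra
  have nz: "1 + (x + h)\<^sup>2 \<noteq> 0" "1 + (x - h)\<^sup>2 \<noteq> 0"
    using zero_le_power2[of "x + h"] zero_le_power2[of "x - h"] by linarith+
  have "psi (x + h) + psi (x - h) = ((1 + (x - h)\<^sup>2) + (1 + (x + h)\<^sup>2)) / D"
    unfolding psi_def D_def using nz by (simp add: add_frac_eq)
  also have "(1 + (x - h)\<^sup>2) + (1 + (x + h)\<^sup>2) = 2 * (w + q)" unfolding w_def p_def q_def by algebra
  finally have "psi (x + h) + psi (x - h) = 2 * (w + q) / D" .
  moreover have "psi x = 1 / w" by (simp add: psi_def w_def p_def)
  ultimately have "psi (x + h) + psi (x - h) - 2 * psi x - h\<^sup>2 * ((6 * x\<^sup>2 - 2) / (1 + x\<^sup>2) ^ 3)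
      = 2 * (w + q) / D - 2 / w - q * ((6 * p - 2) / w ^ 3)"
    by (simp add: p_def q_def w_def)
  also have "\<dots> = (2 * (w + q) * w ^ 3 - 2 * w\<^sup>2 * D - q * (6 * p - 2) * D) / (w ^ 3 * D)"
    using pq D1 by (simp add: field_simps power2_eq_square power3_eq_cube)
  also have "2 * (w + q) * w ^ 3 - 2 * w\<^sup>2 * D - q * (6 * p - 2) * D = - 2 * q\<^sup>2 * N"
    unfolding D N_def w_def by algebra
  finally have eq: "psi (x + h) + psi (x - h) - 2 * psi x - h\<^sup>2 * ((6 * x\<^sup>2 - 2) / (1 + x\<^sup>2) ^ 3)
      = - 2 * q\<^sup>2 * N / (w ^ 3 * D)" .
  \<comment> \<open>Either \<open>q\<close> dominates \<open>p\<close> and then already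
    \<open>q \<le> D\<close>, or \<open>q\<close> is below \<open>2 * p\<close> and hence below
    \<open>2 * w\<close>.\<close>
  have qD: "q \<le> 2 * w\<^sup>2 * D"
  proof (cases "q \<ge> 2 * p")
    case True
    then have "q * q \<ge> 2 * p * q" using pq by (intro mult_right_mono)
    moreover have "D = w\<^sup>2 + 2 * q + (q * q - 2 * p * q)" unfolding D by algebra
    ultimately have "q \<le> D" using pq zero_le_power2[of w] by linarith
    also have "\<dots> \<le> 2 * w\<^sup>2 * D"
      using D1 mult_right_mono[of 1 "2 * w\<^sup>2" D] one_le_power[OF pq(3), of 2] by simp
    finally show ?thesis .
  next
    case False
    then have "q \<le> 2 * w" using pq by (simp add: w_def)
    also have "\<dots> \<le> 2 * (w * w)" using pq mult_left_mono[of 1 w w] by simp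
    also have "\<dots> \<le> 2 * (w * w) * D" using D1 pq mult_left_mono[of 1 D "2 * (w * w)"] by simp
    finally show ?thesis by (simp add: power2_eq_square)
  qed
  have w2: "w\<^sup>2 \<le> w ^ 3 * D"
  proof -
    have "w\<^sup>2 * 1 \<le> w\<^sup>2 * (w * D)" using pq D1 mult_mono[of 1 w 1 D] by (intro mult_left_mono) auto
    then show ?thesis by (simp add: power2_eq_square power3_eq_cube algebra_simps)
  qed
  have "\<bar>N\<bar> \<le> w\<^sup>2 + \<bar>3 * p - 1\<bar> * \<bar>2 - 2 * p + q\<bar>"
    unfolding N_def abs_mult[symmetric]
    using abs_triangle_ineq[of "w\<^sup>2" "(3 * p - 1) * (2 - 2 * p + q)"] by simp
  also have "\<bar>3 * p - 1\<bar> * \<bar>2 - 2 * p + q\<bar> \<le> (3 * w) * (2 * w + q)"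
    using pq unfolding w_def by (intro mult_mono) (auto simp: abs_le_iff)
  also have "(3 * w) * (2 * w + q) = 6 * w\<^sup>2 + 3 * w * q" by (simp add: power2_eq_square algebra_simps)
  also have "3 * w * q \<le> 3 * w * (2 * w\<^sup>2 * D)" using qD pq by (intro mult_left_mono) auto
  also have "3 * w * (2 * w\<^sup>2 * D) = 6 * (w ^ 3 * D)" by (simp add: power2_eq_square power3_eq_cube)
  finally have "\<bar>N\<bar> \<le> 13 * (w ^ 3 * D)" using w2 by linarith
  then have "\<bar>N\<bar> / (w ^ 3 * D) \<le> 13" using pq D1 by (simp add: divide_le_eq)
  then have "2 * q\<^sup>2 * (\<bar>N\<bar> / (w ^ 3 * D)) \<le> 2 * q\<^sup>2 * 13" by (intro mult_left_mono) auto
  moreover have "\<bar>- 2 * q\<^sup>2 * N / (w ^ 3 * D)\<bar> = 2 * q\<^sup>2 * (\<bar>N\<bar> / (w ^ 3 * D))"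
    using pq D1 by (simp add: abs_mult)
  moreover have "q\<^sup>2 = h ^ 4" by (simp add: q_def flip: power_mult)
  ultimately show ?thesis unfolding eq by simp
qed

text \<open>The odd terms cancel by symmetry, and the quadratic ones because
  \<open>u^2 + v^2 = 2 * y^2\<close>. The three quartic remainders add up to
  \<open>26 + 13 = 39\<close>.\<close>

lemma psi_rot_invariance:
  "\<bar>(\<Sum>w\<in>UNIV. flip_pair (1/2) w * psi (x + rot \<alpha> w * y)) -
    (\<Sum>w\<in>UNIV. flip_pair (1/2) w * psi (x + rot 0 w * y))\<bar> \<le> 39 * y ^ 4"
proof -
  let ?d = "(6 * x\<^sup>2 - 2) / (1 + x\<^sup>2) ^ 3"
  let ?R = "\<lambda>h. psi (x + h) + psi (x - h) - 2 * psi x - h\<^sup>2 * ?d"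
  define u v where "u = (cos \<alpha> + sin \<alpha>) * y" and "v = (cos \<alpha> - sin \<alpha>) * y"
  have 1: "(\<Sum>w\<in>UNIV. flip_pair (1/2) w * psi (x + rot \<alpha> w * y)) =
      (psi (x + u) + psi (x - u) + psi (x + v) + psi (x - v)) / 4"
    using sum_rot[of "\<lambda>z. psi (x + z * y)" \<alpha>] by (simp add: u_def v_def algebra_simps)
  have 2: "(\<Sum>w\<in>UNIV. flip_pair (1/2) w * psi (x + rot 0 w * y)) = (psi (x + y) + psi (x - y)) / 2"
    using sum_rot[of "\<lambda>z. psi (x + z * y)" 0] by simp
  have 3: "?R u / 4 + ?R v / 4 - ?R y / 2 =
      (psi (x + u) + psi (x - u) + psi (x + v) + psi (x - v)) / 4 - (psi (x + y) + psi (x - y)) / 2"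
  proof -
    have "u\<^sup>2 + v\<^sup>2 = 2 * ((cos \<alpha>)\<^sup>2 + (sin \<alpha>)\<^sup>2) * y\<^sup>2" unfolding u_def v_def by algebra
    then have "u\<^sup>2 + v\<^sup>2 = 2 * y\<^sup>2" by simp
    moreover have "?R u / 4 + ?R v / 4 - ?R y / 2 =
      (psi (x + u) + psi (x - u) + psi (x + v) + psi (x - v)) / 4 - (psi (x + y) + psi (x - y)) / 2
        - ?d / 4 * (u\<^sup>2 + v\<^sup>2 - 2 * y\<^sup>2)"
      by (simp add: algebra_simps add_divide_distrib diff_divide_distrib)
    ultimately show ?thesis by simp
  qed
  have 4: "u ^ 4 + v ^ 4 \<le> 4 * y ^ 4"
    unfolding u_def v_def power_mult_distrib distrib_right[symmetric]
    by (intro mult_right_mono sum_fourth_powers_le) auto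
  have "\<bar>?R u / 4 + ?R v / 4 - ?R y / 2\<bar> \<le> 26 * u ^ 4 / 4 + 26 * v ^ 4 / 4 + 26 * y ^ 4 / 2"
  proof -
    have "\<bar>a / 4 + b / 4 - c / 2\<bar> \<le> A / 4 + B / 4 + C / 2"
      if "\<bar>a\<bar> \<le> A" "\<bar>b\<bar> \<le> B" "\<bar>c\<bar> \<le> C" for a b c A B C :: real
      using that by linarith
    then show ?thesis using psi_second_difference by blast
  qed
  then show ?thesis unfolding 1 2 3[symmetric] using 4 by linarith
qed

text \<open>A smooth substitute for \<open>(\<bar>x\<bar> - 1)\<^sup>2\<close>, chosen so that its non-quadratic part is bounded.\<close>

definition two_point_gap :: "real \<Rightarrow> real" where
  "two_point_gap x = x\<^sup>2 - 3 + 4 * psi x"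

text \<open>The gap equals \<open>(\<bar>x\<bar> - 1)^2\<close> times
  \<open>(\<bar>x\<bar> + 1)^2 / (1 + x^2)\<close>, and the second factor lies between 1 and
  2.\<close>

lemma two_point_gap_bounds:
  "(\<bar>x\<bar> - 1)\<^sup>2 \<le> two_point_gap x" "two_point_gap x \<le> 2 * (\<bar>x\<bar> - 1)\<^sup>2"
proof -
  have eq: "two_point_gap x = (\<bar>x\<bar> - 1)\<^sup>2 * ((\<bar>x\<bar> + 1)\<^sup>2 / (1 + \<bar>x\<bar>\<^sup>2))"
  proof -
    have "1 + \<bar>x\<bar>\<^sup>2 > 0" using zero_le_power2[of "\<bar>x\<bar>"] by linarith
    moreover have "(\<bar>x\<bar>\<^sup>2 - 3) * (1 + \<bar>x\<bar>\<^sup>2) + 4 = (\<bar>x\<bar> - 1)\<^sup>2 * (\<bar>x\<bar> + 1)\<^sup>2" by algebra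
    moreover have "A + 4 / w = (A * w + 4) / w" if "w > 0" for A w :: real
      using that by (simp add: add_divide_distrib)
    ultimately have "\<bar>x\<bar>\<^sup>2 - 3 + 4 / (1 + \<bar>x\<bar>\<^sup>2) = (\<bar>x\<bar> - 1)\<^sup>2 * (\<bar>x\<bar> + 1)\<^sup>2 / (1 + \<bar>x\<bar>\<^sup>2)"
      by metis
    then show ?thesis by (simp add: two_point_gap_def psi_def)
  qed
  have pos: "1 + \<bar>x\<bar>\<^sup>2 > 0" using zero_le_power2[of "\<bar>x\<bar>"] by linarith
  have "1 + \<bar>x\<bar>\<^sup>2 \<le> (\<bar>x\<bar> + 1)\<^sup>2" by (simp add: power2_eq_square algebra_simps)
  then have 1: "1 \<le> (\<bar>x\<bar> + 1)\<^sup>2 / (1 + \<bar>x\<bar>\<^sup>2)" using pos by (simp add: le_divide_eq)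
  have "2 * (1 + \<bar>x\<bar>\<^sup>2) - (\<bar>x\<bar> + 1)\<^sup>2 = (\<bar>x\<bar> - 1)\<^sup>2" by algebra
  then have "(\<bar>x\<bar> + 1)\<^sup>2 \<le> 2 * (1 + \<bar>x\<bar>\<^sup>2)" using zero_le_power2[of "\<bar>x\<bar> - 1"] by linarith
  then have 2: "(\<bar>x\<bar> + 1)\<^sup>2 / (1 + \<bar>x\<bar>\<^sup>2) \<le> 2" using pos by (simp add: divide_le_eq)
  show "(\<bar>x\<bar> - 1)\<^sup>2 \<le> two_point_gap x" "two_point_gap x \<le> 2 * (\<bar>x\<bar> - 1)\<^sup>2"
    unfolding eq using mult_left_mono[OF 1, of "(\<bar>x\<bar> - 1)\<^sup>2"] mult_left_mono[OF 2, of "(\<bar>x\<bar> - 1)\<^sup>2"]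
    by simp_all
qed

lemma two_point_gap_nonneg: "0 \<le> two_point_gap x"
  by (rule order_trans[OF zero_le_power2 two_point_gap_bounds(1)])

text \<open>Across 0 the jump is \<open>\<bar>x\<bar> + \<bar>y\<bar>\<close>, which cannot be small
  while both moduli are near 1. The quadratic form in \<open>s\<close> and \<open>t\<close> attains
  its minimum 4/3 at \<open>s = t = 1/3\<close>.\<close>

lemma sign_change_le:
  fixes x y :: real
  shows "(if (x > 0) = (y > 0) then 0 else 1) \<le> (x - y)\<^sup>2 + two_point_gap x + two_point_gap y"
proof (cases "(x > 0) = (y > 0)")
  case True
  then show ?thesis
    using two_point_gap_nonneg by simp
next
  case False
  then have "\<bar>x - y\<bar> = \<bar>x\<bar> + \<bar>y\<bar>" by auto
  then have "(x - y)\<^sup>2 = (\<bar>x\<bar> + \<bar>y\<bar>)\<^sup>2" by (metis power2_abs)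
  moreover have "1 \<le> (s + t)\<^sup>2 + (s - 1)\<^sup>2 + (t - 1)\<^sup>2" for s t :: real
  proof -
    have "(s + t)\<^sup>2 + (s - 1)\<^sup>2 + (t - 1)\<^sup>2 = 4/3 + 3/2 * (s + t - 2/3)\<^sup>2 + (s - t)\<^sup>2 / 2"
      by (simp add: power2_eq_square field_simps)
    then show ?thesis
      using zero_le_power2[of "s + t - 2/3"] zero_le_power2[of "s - t"] by linarith
  qed
  ultimately show ?thesis
    using False two_point_gap_bounds(1)[of x] two_point_gap_bounds(1)[of y]
    by (smt (verit))
qed


lemma abs_sin_mult_le: "\<bar>sin (real n * x)\<bar> \<le> n * \<bar>sin x\<bar>"
proof (induction n)
  case (Suc n)
  have "\<bar>sin (real (Suc n) * x)\<bar> = \<bar>sin (n * x) * cos x + cos (n * x) * sin x\<bar>"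
    using sin_add[of "n * x" x] by (simp add: algebra_simps)
  also have "\<dots> \<le> \<bar>sin (n * x)\<bar> * \<bar>cos x\<bar> + \<bar>cos (n * x)\<bar> * \<bar>sin x\<bar>"
    by (rule order_trans[OF abs_triangle_ineq]) (simp add: abs_mult)
  also have "\<dots> \<le> \<bar>sin (n * x)\<bar> * 1 + 1 * \<bar>sin x\<bar>"
    by (intro add_mono mult_mono) auto
  finally show ?case using Suc by (simp add: distrib_right)
qed simp

text \<open>Since \<open>m\<close> steps of this angle reach a right angle, its sine is at least
  \<open>1 / m\<close>. So the squared cosine is at most \<open>exp (- 1 / m^2)\<close>, whose power
  \<open>m^2\<close> is below one half. This determines the degree cut-off
  \<open>2 * m^2\<close>.\<close>

lemma cos_power_le_half:
  assumes "m \<ge> 1"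
  shows "cos (pi / (2 * real m)) ^ (2 * m\<^sup>2) \<le> 1 / 2"
proof -
  let ?x = "pi / (2 * real m)"
  have "1 \<le> m * \<bar>sin ?x\<bar>" using abs_sin_mult_le[of m ?x] assms by simp
  then have "1 / m \<le> \<bar>sin ?x\<bar>" using assms by (simp add: divide_le_eq mult.commute)
  then have "(1 / m)\<^sup>2 \<le> (sin ?x)\<^sup>2" by (metis divide_nonneg_nonneg of_nat_0_le_iff power2_abs power_mono zero_le_one)
  then have "(cos ?x)\<^sup>2 \<le> 1 - (1 / m)\<^sup>2" using sin_cos_squared_add[of ?x] by linarith
  also have "\<dots> \<le> exp (- ((1 / m)\<^sup>2))" using exp_ge_add_one_self[of "- ((1 / real m)\<^sup>2)"] by simp
  finally have "((cos ?x)\<^sup>2) ^ m\<^sup>2 \<le> exp (- ((1 / m)\<^sup>2)) ^ m\<^sup>2" by (intro power_mono) auto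
  also have "\<dots> = exp (- 1)"
    using assms by (simp flip: exp_of_nat_mult) (simp add: power_divide)
  also have "\<dots> \<le> 1 / 2" using exp_ge_add_one_self[of 1] by (simp add: exp_minus field_simps)
  finally show ?thesis by (simp add: power_mult)
qed

lemma mlin_diff: "mlin (\<lambda>S. a S - b S) I z = mlin a I z - mlin b I z"
  by (simp add: mlin_def left_diff_distrib sum_subtractf)

lemma rot_0: "rot 0 w = bsign (fst w)"
  and rot_pi_half: "rot (pi / 2) w = bsign (snd w)"
  by (simp_all add: rot_def)

lemma expansion_fst_pt:
  assumes "\<And>x. x \<in> I \<rightarrow>\<^sub>E UNIV \<Longrightarrow> f x = mlin a I (\<lambda>i. bsign (x i))"
  shows "f (fst_pt I w) = mlin a I (\<lambda>i. bsign (fst (w i)))"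
    and "f (snd_pt I w) = mlin a I (\<lambda>i. bsign (snd (w i)))"
  by (subst assms; auto intro!: mlin_cong)+

text \<open>The value 0 is assigned to the negative side, which makes this a pseudometric on all
  reals.\<close>

definition disagree :: "real \<Rightarrow> real \<Rightarrow> real" where
  "disagree x y = (if (x > 0) = (y > 0) then 0 else 1)"

lemma disagree_triangle: "disagree x z \<le> disagree x y + disagree y z"
  by (simp add: disagree_def)

lemma disagree_path: "disagree (q 0) (q n) \<le> (\<Sum>j<n. disagree (q j) (q (Suc j)))"
proof (induction n)
  case (Suc n)
  then show ?case using disagree_triangle[of "q 0" "q (Suc n)" "q n"] by simp
qed (simp add: disagree_def)

section \<open>Low-degree truncation and the noise inequality for cuts\<close>

definition truncate :: "nat \<Rightarrow> ('i set \<Rightarrow> real) \<Rightarrow> 'i set \<Rightarrow> real" where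
  "truncate d a = (\<lambda>S. if card S \<le> d then a S else 0)"

definition tail_weight :: "'i set \<Rightarrow> nat \<Rightarrow> ('i set \<Rightarrow> real) \<Rightarrow> real" where
  "tail_weight I d a = (\<Sum>S\<in>Pow I. (truncate d a S - a S)\<^sup>2)"

lemma truncate_sq_dist:
  assumes "finite I"
  shows "pexp (flip_pair (1/2)) I
    (\<lambda>w. (mlin (truncate d a) I (\<lambda>i. rot \<alpha> (w i)) - mlin a I (\<lambda>i. rot \<alpha> (w i)))\<^sup>2) = tail_weight I d a"
  using rot_energy(2)[OF assms, of "\<lambda>S. truncate d a S - a S"] by (simp add: mlin_diff tail_weight_def)

text \<open>At angle 0 the full polynomial takes the values of \<open>f\<close>, of modulus 1, so
  the gap of the truncation is at most twice its squared distance to \<open>f\<close>. At another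
  angle the second moment is the same and only the \<open>psi\<close> term moves, by the Lindeberg
  error; \<open>156 = 4 * 39\<close>.\<close>

lemma truncated_gap:
  fixes f :: "('i \<Rightarrow> bit) \<Rightarrow> real"
  assumes I: "finite I"
    and f: "\<And>x. x \<in> I \<rightarrow>\<^sub>E UNIV \<Longrightarrow> f x = mlin a I (\<lambda>i. bsign (x i))"
    and f1: "\<And>x. x \<in> I \<rightarrow>\<^sub>E UNIV \<Longrightarrow> \<bar>f x\<bar> = 1"
  shows "pexp (flip_pair (1/2)) I (\<lambda>w. two_point_gap (mlin (truncate d a) I (\<lambda>i. rot \<alpha> (w i)))) \<le>
    2 * tail_weight I d a + 156 * 9 ^ d * (\<Sum>i\<in>I. (coord_weight I (truncate d a) i)\<^sup>2)"
proof -
  let ?p = "flip_pair (1/2)" and ?b = "truncate d a"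
  let ?Q = "\<lambda>\<alpha> w. mlin ?b I (\<lambda>i. rot \<alpha> (w i))"
  let ?S = "\<Sum>i\<in>I. (coord_weight I ?b i)\<^sup>2"
  have p: "prob_weight ?p" by (rule prob_weight_flip_pair) auto
  have "\<bar>pexp ?p I (\<lambda>w. psi (?Q \<alpha> w)) - pexp ?p I (\<lambda>w. psi (?Q 0 w))\<bar> \<le> 39 * 9 ^ d * ?S"
    by (rule lindeberg[OF p I]) (auto simp: bonami_rv_rot truncate_def psi_rot_invariance)
  moreover have gap: "pexp ?p I (\<lambda>w. two_point_gap (?Q \<beta> w)) =
      (\<Sum>S\<in>Pow I. (?b S)\<^sup>2) - 3 + 4 * pexp ?p I (\<lambda>w. psi (?Q \<beta> w))" for \<beta>
    unfolding two_point_gap_def pexp_add pexp_diff pexp_cmult rot_energy(2)[OF I] pexp_const[OF p I] ..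
  ultimately have "pexp ?p I (\<lambda>w. two_point_gap (?Q \<alpha> w)) \<le>
      pexp ?p I (\<lambda>w. two_point_gap (?Q 0 w)) + 4 * (39 * 9 ^ d * ?S)"
    unfolding gap by linarith
  also have "pexp ?p I (\<lambda>w. two_point_gap (?Q 0 w)) \<le>
      pexp ?p I (\<lambda>w. 2 * (?Q 0 w - mlin a I (\<lambda>i. rot 0 (w i)))\<^sup>2)"
  proof (rule pexp_mono[OF p])
    fix w :: "'i \<Rightarrow> bit \<times> bit"
    have "\<bar>mlin a I (\<lambda>i. rot 0 (w i))\<bar> = 1"
      using f1[of "fst_pt I w"] expansion_fst_pt(1)[of I f a w, OF f] by (simp add: rot_0)
    then have "\<bar>\<bar>?Q 0 w\<bar> - 1\<bar> \<le> \<bar>?Q 0 w - mlin a I (\<lambda>i. rot 0 (w i))\<bar>" by linarith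
    then have "(\<bar>?Q 0 w\<bar> - 1)\<^sup>2 \<le> (?Q 0 w - mlin a I (\<lambda>i. rot 0 (w i)))\<^sup>2" by (simp add: abs_le_square_iff)
    then show "two_point_gap (?Q 0 w) \<le> 2 * (?Q 0 w - mlin a I (\<lambda>i. rot 0 (w i)))\<^sup>2"
      using two_point_gap_bounds(2)[of "?Q 0 w"] by linarith
  qed
  also have "\<dots> = 2 * tail_weight I d a" unfolding pexp_cmult truncate_sq_dist[OF I] ..
  finally show ?thesis by simp
qed


lemma noise_energy_boolean:
  fixes f :: "('i \<Rightarrow> bit) \<Rightarrow> real"
  assumes "0 \<le> t" "t \<le> 1" "finite I"
    and f: "\<And>x. x \<in> I \<rightarrow>\<^sub>E UNIV \<Longrightarrow> f x = mlin a I (\<lambda>i. bsign (x i))"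
  shows "pexp (flip_pair t) I (\<lambda>w. (f (fst_pt I w) - f (snd_pt I w))\<^sup>2) =
    2 * (\<Sum>S\<in>Pow I. (a S)\<^sup>2 * (1 - (1 - 2 * t) ^ card S))"
  unfolding noise_energy[OF assms(1-3), symmetric]
  by (simp add: expansion_fst_pt[of I f a, OF f])

text \<open>A monomial of degree above \<open>d\<close> keeps at most half of its correlation, so at
  least half of its weight shows up in the sum on the right, which including its factor 2 is the
  noise energy when \<open>\<rho> = 1 - 2 * t\<close>.\<close>

lemma tail_weight_le:
  assumes \<rho>: "0 \<le> \<rho>" "\<rho> \<le> 1" "\<rho> ^ d \<le> 1 / 2"
  shows "tail_weight I d a \<le> 2 * (\<Sum>S\<in>Pow I. (a S)\<^sup>2 * (1 - \<rho> ^ card S))"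
  unfolding tail_weight_def sum_distrib_left
proof (intro sum_mono)
  fix S assume "S \<in> Pow I"
  have 1: "\<rho> ^ card S \<le> 1" using \<rho> by (simp add: power_le_one)
  show "(truncate d a S - a S)\<^sup>2 \<le> 2 * ((a S)\<^sup>2 * (1 - \<rho> ^ card S))"
  proof (cases "card S \<le> d")
    case True
    then show ?thesis using 1 by (simp add: truncate_def)
  next
    case False
    then have "\<rho> ^ card S \<le> 1 / 2" using \<rho> power_decreasing[of d "card S" \<rho>] by simp
    then have "(a S)\<^sup>2 * 1 \<le> (a S)\<^sup>2 * (2 * (1 - \<rho> ^ card S))" by (intro mult_left_mono) auto
    then show ?thesis using False by (simp add: truncate_def algebra_simps)
  qed
qed

text \<open>By symmetry all coordinates have the same low-degree influence, so each is at most
  \<open>d / card I\<close> times the variance. This replaces the usual smallness assumption on influences.\<close>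

lemma sum_coord_weight_sq_le:
  assumes I: "finite I" and sym: "transitively_symmetric I f"
    and f: "\<And>x. x \<in> I \<rightarrow>\<^sub>E UNIV \<Longrightarrow> f x = mlin a I (\<lambda>i. bsign (x i))"
    and a: "(\<Sum>S\<in>Pow I. (a S)\<^sup>2) \<le> 1"
  shows "card I * (\<Sum>i\<in>I. (coord_weight I (truncate d a) i)\<^sup>2) \<le>
    (real d)\<^sup>2 * (\<Sum>S\<in>Pow I. (a S)\<^sup>2 * (1 - 0 ^ card S))"
proof (cases "I = {}")
  case True
  then show ?thesis by simp
next
  case False
  \<comment> \<open>\<open>0 ^ card S\<close> is 1 for the empty set only, so \<open>V\<close> is
    the variance; in this form it matches the energy formula at \<open>t = 1/2\<close>.\<close>
  define V where "V = (\<Sum>S\<in>Pow I. (a S)\<^sup>2 * (1 - 0 ^ card S))"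
  obtain j where j: "j \<in> I" using False by blast
  define v where "v = coord_weight I (truncate d a) j"
  have v: "coord_weight I (truncate d a) i = v" if "i \<in> I" for i
    unfolding v_def truncate_def by (rule coord_weight_symmetric[OF I sym f that j])
  have V: "0 \<le> V" "V \<le> 1"
    unfolding V_def by (auto intro!: sum_nonneg order_trans[OF sum_mono a] simp: mult_left_le power_0_left)
  have "card I * v = (\<Sum>i\<in>I. coord_weight I (truncate d a) i)" using v by simp
  also have "\<dots> = (\<Sum>S\<in>Pow I. real (card S) * (truncate d a S)\<^sup>2)" by (rule sum_coord_weight[OF I])
  also have "\<dots> \<le> d * V"
    unfolding V_def sum_distrib_left by (intro sum_mono) (auto simp: truncate_def power_0_left intro!: mult_right_mono)
  finally have "card I * v \<le> d * V" .
  moreover have "v \<ge> 0" by (simp add: v_def coord_weight_def sum_nonneg)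
  ultimately have "(card I * v)\<^sup>2 \<le> (d * V)\<^sup>2" by (intro power_mono) auto
  also have "\<dots> = (real d)\<^sup>2 * (V * V)" by (simp add: power2_eq_square)
  \<comment> \<open>Since \<open>V \<le> 1\<close>, the square is lowered to a first power: the
    error becomes proportional to the variance and can be absorbed by it.\<close>
  also have "\<dots> \<le> (real d)\<^sup>2 * V" using V mult_left_le[of V V] by (intro mult_left_mono) auto
  finally show ?thesis using v unfolding V_def[symmetric] by (simp add: power2_eq_square algebra_simps)
qed

text \<open>With \<open>D\<close> the noise energy, each of the \<open>m\<close> steps of the path
  changes sign with probability at most \<open>D + 4 * W + 2 * R\<close>. The tail satisfies
  \<open>W \<le> D\<close>, and the size of \<open>I\<close> forces
  \<open>2 * m * R \<le> V / 4\<close>, so that \<open>V / 4 \<le> 7 * m * D\<close>; multiplying by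
  8 gives the constant 56.\<close>

lemma cut_noise:
  fixes f :: "('i \<Rightarrow> bit) \<Rightarrow> real"
  assumes I: "finite I" and m: "m \<ge> 1" and big: "5000 * real m ^ 5 * 81 ^ m\<^sup>2 \<le> card I"
    and sym: "transitively_symmetric I f"
    and f1: "\<And>x. x \<in> I \<rightarrow>\<^sub>E UNIV \<Longrightarrow> \<bar>f x\<bar> = 1"
    and t: "1 - 2 * t = cos (pi / (2 * real m))"
  shows "pexp (flip_pair (1/2)) I (\<lambda>w. (f (fst_pt I w) - f (snd_pt I w))\<^sup>2) \<le>
    56 * m * pexp (flip_pair t) I (\<lambda>w. (f (fst_pt I w) - f (snd_pt I w))\<^sup>2)"
proof -
  obtain a where "\<forall>x\<in>I \<rightarrow>\<^sub>E UNIV. f x = mlin a I (\<lambda>i. bsign (x i))"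
    using walsh_expansion[OF I] by blast
  then have f: "f x = mlin a I (\<lambda>i. bsign (x i))" if "x \<in> I \<rightarrow>\<^sub>E UNIV" for x using that by blast
  let ?p = "flip_pair (1/2)"
  have p: "prob_weight ?p" by (rule prob_weight_flip_pair) auto
  define \<theta> where "\<theta> = pi / (2 * real m)"
  define \<rho> where "\<rho> = cos \<theta>"
  define d where "d = 2 * m\<^sup>2"
  define V where "V = (\<Sum>S\<in>Pow I. (a S)\<^sup>2 * (1 - 0 ^ card S))"
  define D where "D = 2 * (\<Sum>S\<in>Pow I. (a S)\<^sup>2 * (1 - \<rho> ^ card S))"
  define W where "W = tail_weight I d a"
  define R where "R = 156 * 9 ^ d * (\<Sum>i\<in>I. (coord_weight I (truncate d a) i)\<^sup>2)"
  \<comment> \<open>The truncated polynomial after \<open>j\<close> rotations: \<open>q 0\<close>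
    sees only the first sign vector, \<open>q m\<close> only the second.\<close>
  define q where "q = (\<lambda>(j::nat) w. mlin (truncate d a) I (\<lambda>i. rot (j * \<theta>) (w i)))"
  have \<theta>: "0 \<le> \<theta>" "\<theta> \<le> pi / 2" using m by (auto simp: \<theta>_def field_simps)
  have \<rho>: "0 \<le> \<rho>" "\<rho> \<le> 1" unfolding \<rho>_def using \<theta> by (auto intro: cos_ge_zero)
  have \<rho>d: "\<rho> ^ d \<le> 1 / 2" unfolding \<rho>_def d_def \<theta>_def by (rule cos_power_le_half[OF m])
  have "1 - 2 * t = \<rho>" using t by (simp add: \<rho>_def \<theta>_def)
  with \<rho> have t': "1 - 2 * t = \<rho>" "0 \<le> t" "t \<le> 1" by linarith+
  have WD: "W \<le> D" unfolding W_def D_def by (rule tail_weight_le[OF \<rho> \<rho>d])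
  have ED: "pexp (flip_pair t) I (\<lambda>w. (f (fst_pt I w) - f (snd_pt I w))\<^sup>2) = D"
    unfolding D_def t'(1)[symmetric] by (rule noise_energy_boolean[OF t'(2,3) I f])
  have EV: "pexp ?p I (\<lambda>w. (f (fst_pt I w) - f (snd_pt I w))\<^sup>2) = 2 * V"
    unfolding V_def using noise_energy_boolean[of "1/2" I f a, OF _ _ I f] by simp
  have "(\<Sum>S\<in>Pow I. (a S)\<^sup>2) = pexp coin I (\<lambda>x. 1)"
    unfolding pexp_coin_mlin_square[OF I, symmetric]
    using f f1 by (intro pexp_cong) (metis power2_abs power_one)
  then have a1: "(\<Sum>S\<in>Pow I. (a S)\<^sup>2) = 1" by (simp add: pexp_const[OF prob_weight_coin I])
  have gap: "pexp ?p I (\<lambda>w. two_point_gap (q j w)) \<le> 2 * W + R" for j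
    unfolding q_def W_def R_def by (rule truncated_gap[OF I f f1])
  \<comment> \<open>Neighbouring points of the path are correlated like a noisy pair, and truncation
    only discards nonnegative terms.\<close>
  have step: "pexp ?p I (\<lambda>w. (q j w - q (Suc j) w)\<^sup>2) \<le> D" for j
  proof -
    have "cos (real j * \<theta> - real (Suc j) * \<theta>) = \<rho>" by (simp add: \<rho>_def algebra_simps)
    then have "pexp ?p I (\<lambda>w. (q j w - q (Suc j) w)\<^sup>2) =
        2 * (\<Sum>S\<in>Pow I. (truncate d a S)\<^sup>2 * (1 - \<rho> ^ card S))"
      unfolding q_def rot_energy(1)[OF I] by simp
    also have "\<dots> \<le> D"
      unfolding D_def using \<rho>
      by (intro mult_left_mono sum_mono mult_right_mono) (auto simp: truncate_def power_le_one)
    finally show ?thesis .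
  qed
  have dis_step: "pexp ?p I (\<lambda>w. disagree (q j w) (q (Suc j) w)) \<le> D + 2 * (2 * W + R)" for j
  proof -
    have "pexp ?p I (\<lambda>w. disagree (q j w) (q (Suc j) w)) \<le>
        pexp ?p I (\<lambda>w. (q j w - q (Suc j) w)\<^sup>2 + two_point_gap (q j w) + two_point_gap (q (Suc j) w))"
      unfolding disagree_def by (intro pexp_mono[OF p] sign_change_le)
    also have "\<dots> \<le> D + (2 * W + R) + (2 * W + R)"
      unfolding pexp_add by (intro add_mono step gap)
    finally show ?thesis by simp
  qed
  have ends: "mlin a I (\<lambda>i. rot 0 (w i)) = f (fst_pt I w)"
    "mlin a I (\<lambda>i. rot (pi / 2) (w i)) = f (snd_pt I w)" for w
    using expansion_fst_pt[of I f a w, OF f] by (simp_all add: rot_0 rot_pi_half)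
  have f1': "\<bar>f (fst_pt I w)\<bar> = 1" "\<bar>f (snd_pt I w)\<bar> = 1" for w
    by (simp_all add: f1)
  \<comment> \<open>At both ends the untruncated polynomial has modulus 1, so a wrong sign of the
    truncation means an error of at least 1.\<close>
  have end_dis: "pexp ?p I (\<lambda>w. disagree (mlin (truncate d a) I (\<lambda>i. rot \<alpha> (w i)))
      (mlin a I (\<lambda>i. rot \<alpha> (w i)))) \<le> W" if \<alpha>: "\<alpha> = 0 \<or> \<alpha> = pi / 2" for \<alpha>
    unfolding W_def truncate_sq_dist[OF I, of d a \<alpha>, symmetric]
  proof (rule pexp_mono[OF p])
    fix w :: "'i \<Rightarrow> bit \<times> bit"
    have "\<bar>mlin a I (\<lambda>i. rot \<alpha> (w i))\<bar> = 1"
      using \<alpha> ends f1' by metis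
    moreover have "disagree x y \<le> (x - y)\<^sup>2" if "\<bar>y\<bar> = 1" for x y
    proof -
      have "1 \<le> \<bar>x - y\<bar>" if "(x > 0) \<noteq> (y > 0)" using that \<open>\<bar>y\<bar> = 1\<close> by auto
      then show ?thesis using one_le_power[of "\<bar>x - y\<bar>" 2] by (auto simp: disagree_def)
    qed
    ultimately show "disagree (mlin (truncate d a) I (\<lambda>i. rot \<alpha> (w i))) (mlin a I (\<lambda>i. rot \<alpha> (w i)))
        \<le> (mlin (truncate d a) I (\<lambda>i. rot \<alpha> (w i)) - mlin a I (\<lambda>i. rot \<alpha> (w i)))\<^sup>2" by blast
  qed
  have q0: "pexp ?p I (\<lambda>w. disagree (f (fst_pt I w)) (q 0 w)) \<le> W"
    and qm: "pexp ?p I (\<lambda>w. disagree (q m w) (f (snd_pt I w))) \<le> W"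
  proof -
    have comm: "disagree x y = disagree y x" for x y by (auto simp: disagree_def)
    have m\<theta>: "real m * \<theta> = pi / 2" using m by (simp add: \<theta>_def)
    show "pexp ?p I (\<lambda>w. disagree (f (fst_pt I w)) (q 0 w)) \<le> W"
      using end_dis[of 0] unfolding ends q_def comm[of "f _"] by simp
    show "pexp ?p I (\<lambda>w. disagree (q m w) (f (snd_pt I w))) \<le> W"
      using end_dis[of "pi / 2"] unfolding ends q_def m\<theta> by simp
  qed
  \<comment> \<open>Distinct signs differ by 2, so the squared difference is four times the
    disagreement.\<close>
  have "V / 2 = pexp ?p I (\<lambda>w. disagree (f (fst_pt I w)) (f (snd_pt I w)))"
  proof -
    have "(f (fst_pt I w) - f (snd_pt I w))\<^sup>2 = 4 * disagree (f (fst_pt I w)) (f (snd_pt I w))" for w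
      using f1'[of w] by (auto simp: disagree_def abs_if split: if_splits)
    then show ?thesis using EV by (simp add: pexp_cmult)
  qed
  also have "\<dots> \<le> pexp ?p I (\<lambda>w. disagree (f (fst_pt I w)) (q 0 w) +
      (\<Sum>j<m. disagree (q j w) (q (Suc j) w)) + disagree (q m w) (f (snd_pt I w)))"
  proof (rule pexp_mono[OF p])
    fix w
    show "disagree (f (fst_pt I w)) (f (snd_pt I w)) \<le> disagree (f (fst_pt I w)) (q 0 w) +
      (\<Sum>j<m. disagree (q j w) (q (Suc j) w)) + disagree (q m w) (f (snd_pt I w))"
      using disagree_triangle[of "f (fst_pt I w)" "f (snd_pt I w)" "q 0 w"]
        disagree_triangle[of "q 0 w" "f (snd_pt I w)" "q m w"] disagree_path[of "\<lambda>j. q j w" m]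
      by linarith
  qed
  also have "\<dots> \<le> W + m * (D + 2 * (2 * W + R)) + W"
    unfolding pexp_add pexp_sum
    using q0 qm sum_mono[of "{..<m}" "\<lambda>j. pexp ?p I (\<lambda>w. disagree (q j w) (q (Suc j) w))"
        "\<lambda>_. D + 2 * (2 * W + R)"] dis_step by simp
  finally have main: "V / 2 \<le> 2 * W + m * (D + 2 * (2 * W + R))" by simp
  \<comment> \<open>Here \<open>1248 = 8 * 156\<close>, and \<open>d^2 = 4 * m^4\<close> produces
    4992, just below the 5000 in the assumption \<open>big\<close>.\<close>
  have VR: "2 * m * R \<le> V / 4"
  proof -
    let ?s = "\<Sum>i\<in>I. (coord_weight I (truncate d a) i)\<^sup>2"
    have V0: "V \<ge> 0" unfolding V_def by (auto intro!: sum_nonneg simp: power_0_left)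
    have s0: "?s \<ge> 0" by (simp add: sum_nonneg)
    have "9 ^ d = (81::real) ^ m\<^sup>2" by (simp add: d_def power_mult)
    then have "5000 * real m ^ 5 * 81 ^ m\<^sup>2 * (8 * m * R) =
        (5000 * real m ^ 5 * 81 ^ m\<^sup>2 * ?s) * (1248 * m * 81 ^ m\<^sup>2)"
      by (simp add: R_def)
    also have "\<dots> \<le> (card I * ?s) * (1248 * m * 81 ^ m\<^sup>2)"
      using big s0 by (intro mult_right_mono) auto
    also have "\<dots> \<le> ((real d)\<^sup>2 * V) * (1248 * m * 81 ^ m\<^sup>2)"
      unfolding V_def using sum_coord_weight_sq_le[OF I sym f, of d] a1 by (intro mult_right_mono) auto
    also have "\<dots> = (4992 * real m ^ 5 * 81 ^ m\<^sup>2) * V"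
      by (simp add: d_def power_mult_distrib power2_eq_square eval_nat_numeral)
    also have "\<dots> \<le> (5000 * real m ^ 5 * 81 ^ m\<^sup>2) * V"
      using V0 by (intro mult_right_mono) auto
    finally have "5000 * real m ^ 5 * 81 ^ m\<^sup>2 * (8 * m * R) \<le> 5000 * real m ^ 5 * 81 ^ m\<^sup>2 * V" .
    moreover have "0 < 5000 * real m ^ 5 * 81 ^ m\<^sup>2" using m by simp
    ultimately have "8 * m * R \<le> V" using mult_le_cancel_left_pos by blast
    then show ?thesis by simp
  qed
  have "m * (D + 2 * (2 * W + R)) \<le> m * (5 * D + 2 * R)" using WD by (intro mult_left_mono) auto
  then have "V / 2 \<le> 2 * D + m * (5 * D) + 2 * m * R" using main WD by (simp add: algebra_simps)
  then have "V / 4 \<le> 2 * D + 5 * (m * D)" using VR by (simp add: algebra_simps)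
  moreover have "D \<le> m * D"
  proof -
    have "D \<ge> 0" unfolding D_def using \<rho> by (auto intro!: sum_nonneg simp: power_le_one)
    then show ?thesis using m mult_right_mono[of 1 "real m" D] by simp
  qed
  ultimately have "2 * V \<le> 56 * (m * D)" by linarith
  then show ?thesis unfolding ED EV by simp
qed

section \<open>From cuts to maps into \<open>L\<^sub>1\<close>\<close>

lemma pexp_integral:
  assumes "finite I" and "\<And>w. w \<in> I \<rightarrow>\<^sub>E UNIV \<Longrightarrow> integrable M (T w)"
  shows "integrable M (\<lambda>s. pexp p I (\<lambda>w. T w s))"
    and "(\<integral>s. pexp p I (\<lambda>w. T w s) \<partial>M) = pexp p I (\<lambda>w. \<integral>s. T w s \<partial>M)"
  unfolding pexp_def using assms
  by (auto intro!: integrable_sum integrable_mult_right simp: integral_sum)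

text \<open>The cuts of \<open>x\<close> and \<open>y\<close> at level \<open>s\<close> differ
  exactly for \<open>s\<close> between the two numbers, and then by 2.\<close>

lemma integral_level_cuts:
  fixes x y :: real
  shows "integrable lborel (\<lambda>s. ((if x > s then 1 else - 1) - (if y > s then 1 else - 1 :: real))\<^sup>2)"
    and "(\<integral>s. ((if x > s then 1 else - 1) - (if y > s then 1 else - 1 :: real))\<^sup>2 \<partial>lborel) = 4 * \<bar>x - y\<bar>"
proof -
  have eq: "(\<lambda>s. ((if x > s then 1 else - 1) - (if y > s then 1 else - 1 :: real))\<^sup>2) =
      (\<lambda>s. 4 * indicator {min x y..<max x y} s)"
    by (auto simp: fun_eq_iff indicator_def min_def max_def)
  show "integrable lborel (\<lambda>s. ((if x > s then 1 else - 1) - (if y > s then 1 else - 1 :: real))\<^sup>2)"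
    unfolding eq by (intro integrable_mult_right integrable_real_indicator) (auto simp: min_def max_def)
  show "(\<integral>s. ((if x > s then 1 else - 1) - (if y > s then 1 else - 1 :: real))\<^sup>2 \<partial>lborel) = 4 * \<bar>x - y\<bar>"
    unfolding eq by (auto simp: min_def max_def)
qed

lemma transitively_symmetric_comp:
  assumes "transitively_symmetric I F"
  shows "transitively_symmetric I (\<lambda>x. g (F x))"
  unfolding transitively_symmetric_def
proof (intro ballI)
  fix i j assume "i \<in> I" "j \<in> I"
  then obtain h where "h permutes I" "h i = j" "\<And>x. x \<in> I \<rightarrow>\<^sub>E UNIV \<Longrightarrow> F (x \<circ> h) = F x"
    using assms unfolding transitively_symmetric_def by meson
  then show "\<exists>h. h permutes I \<and> h i = j \<and> (\<forall>x\<in>I \<rightarrow>\<^sub>E UNIV. g (F (x \<circ> h)) = g (F x))"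
    by (intro exI[of _ h]) simp
qed

text \<open>Each level cut of \<open>h\<close> is a sign function with the same symmetries, so
  \<open>cut_noise\<close> applies with a constant independent of the level. Integration over levels
  turns squared cuts into absolute differences.\<close>

lemma real_noise:
  fixes h :: "('i \<Rightarrow> bit) \<Rightarrow> real"
  assumes I: "finite I" and m: "m \<ge> 1" and big: "5000 * real m ^ 5 * 81 ^ m\<^sup>2 \<le> card I"
    and sym: "transitively_symmetric I h"
    and t: "1 - 2 * t = cos (pi / (2 * real m))"
  shows "pexp (flip_pair (1/2)) I (\<lambda>w. \<bar>h (fst_pt I w) - h (snd_pt I w)\<bar>) \<le>
    56 * real m * pexp (flip_pair t) I (\<lambda>w. \<bar>h (fst_pt I w) - h (snd_pt I w)\<bar>)"
proof -
  define c where "c = (\<lambda>(s::real) x. if h x > s then 1 else - 1 :: real)"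
  define T where "T = (\<lambda>w s. (c s (fst_pt I w) - c s (snd_pt I w))\<^sup>2)"
  have int: "integrable lborel (T w)"
    and val: "(\<integral>s. T w s \<partial>lborel) = 4 * \<bar>h (fst_pt I w) - h (snd_pt I w)\<bar>" for w
    unfolding T_def c_def by (rule integral_level_cuts)+
  have "pexp (flip_pair (1/2)) I (\<lambda>w. T w s) \<le> 56 * real m * pexp (flip_pair t) I (\<lambda>w. T w s)" for s
    unfolding T_def
  proof (rule cut_noise[OF I m big _ _ t])
    show "transitively_symmetric I (c s)"
      unfolding c_def by (rule transitively_symmetric_comp[OF sym])
    show "\<bar>c s x\<bar> = 1" for x by (simp add: c_def)
  qed
  then have "(\<integral>s. pexp (flip_pair (1/2)) I (\<lambda>w. T w s) \<partial>lborel) \<le>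
      (\<integral>s. 56 * real m * pexp (flip_pair t) I (\<lambda>w. T w s) \<partial>lborel)"
    by (intro integral_mono integrable_mult_right pexp_integral(1)[OF I int])
  then show ?thesis
    by (simp add: pexp_integral(2)[OF I int] val pexp_cmult)
qed

text \<open>For fixed \<open>s\<close> the map \<open>x \<mapsto> F x s\<close> is real valued and
  inherits the symmetry, so the real inequality can be integrated over \<open>M\<close>.\<close>

lemma L1_noise:
  fixes F :: "('i \<Rightarrow> bit) \<Rightarrow> 'b \<Rightarrow> real"
  assumes I: "finite I" and m: "m \<ge> 1" and big: "5000 * real m ^ 5 * 81 ^ m\<^sup>2 \<le> card I"
    and sym: "transitively_symmetric I F"
    and t: "1 - 2 * t = cos (pi / (2 * real m))"
    and F: "\<And>x. x \<in> I \<rightarrow>\<^sub>E UNIV \<Longrightarrow> integrable M (F x)"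
  shows "pexp (flip_pair (1/2)) I (\<lambda>w. \<integral>s. \<bar>F (fst_pt I w) s - F (snd_pt I w) s\<bar> \<partial>M) \<le>
    56 * real m * pexp (flip_pair t) I (\<lambda>w. \<integral>s. \<bar>F (fst_pt I w) s - F (snd_pt I w) s\<bar> \<partial>M)"
proof -
  define T where "T = (\<lambda>w s. \<bar>F (fst_pt I w) s - F (snd_pt I w) s\<bar>)"
  have int: "integrable M (T w)" for w
    unfolding T_def by (intro integrable_abs Bochner_Integration.integrable_diff F) auto
  have "pexp (flip_pair (1/2)) I (\<lambda>w. T w s) \<le> 56 * real m * pexp (flip_pair t) I (\<lambda>w. T w s)" for s
    unfolding T_def
    by (rule real_noise[OF I m big transitively_symmetric_comp[OF sym] t])
  then have "(\<integral>s. pexp (flip_pair (1/2)) I (\<lambda>w. T w s) \<partial>M) \<le>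
      (\<integral>s. 56 * real m * pexp (flip_pair t) I (\<lambda>w. T w s) \<partial>M)"
    by (intro integral_mono integrable_mult_right pexp_integral(1)[OF I int])
  then show ?thesis
    by (simp add: pexp_integral(2)[OF I int]) (simp add: T_def)
qed

section \<open>Distances in the cube\<close>

lemma pexp_coord:
  assumes "prob_weight p" "finite I" "i \<in> I"
  shows "pexp p I (\<lambda>w. F (w i)) = (\<Sum>a\<in>UNIV. p a * F a)"
proof -
  have "I = insert i (I - {i})" using assms by auto
  then have "pexp p I (\<lambda>w. F (w i)) = pexp p (insert i (I - {i})) (\<lambda>w. F (w i))" by simp
  also have "\<dots> = (\<Sum>a\<in>UNIV. p a * F a)"
    using assms by (subst pexp_insert) (simp_all add: pexp_const)
  finally show ?thesis .
qed

lemma pexp_prod: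
  assumes "finite I"
  shows "pexp p I (\<lambda>w. \<Prod>i\<in>I. F i (w i)) = (\<Prod>i\<in>I. \<Sum>a\<in>UNIV. p a * F i a)"
  using assms
proof (induction I rule: finite_induct)
  case (insert i I)
  have *: "(\<Prod>j\<in>I. F j ((w(i := a)) j)) = (\<Prod>j\<in>I. F j (w j))" for w a
    using insert.hyps by (intro prod.cong) auto
  have "pexp p (insert i I) (\<lambda>w. \<Prod>j\<in>insert i I. F j (w j)) =
      pexp p I (\<lambda>w. (\<Sum>a\<in>UNIV. p a * F i a) * (\<Prod>j\<in>I. F j (w j)))"
    using insert.hyps by (simp add: pexp_insert * sum_distrib_right mult.assoc del: fun_upd_apply)
      (simp add: mult.assoc)
  then show ?case using insert by (simp add: pexp_cmult)
qed simp

text \<open>With flip probability 1/2 all four bit pairs have weight 1/4, the product law of two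
  coins.\<close>

lemma pexp_independent:
  assumes "finite I"
  shows "pexp (flip_pair (1/2)) I (\<lambda>w. H (fst_pt I w) (snd_pt I w)) = pexp coin I (\<lambda>x. pexp coin I (H x))"
  using assms
proof (induction I arbitrary: H rule: finite_induct)
  case empty
  then show ?case by (simp add: restrict_def)
next
  case (insert i I)
  define K where "K = (\<lambda>x y. \<Sum>a\<in>UNIV. coin a * (\<Sum>b\<in>UNIV. coin b * H (x(i := a)) (y(i := b))))"
  have upd: "fst_pt (insert i I) (w(i := c)) = (fst_pt I w)(i := fst c)"
    "snd_pt (insert i I) (w(i := c)) = (snd_pt I w)(i := snd c)" for w :: "'a \<Rightarrow> bit \<times> bit" and c
    using insert.hyps by (auto simp: restrict_def fun_eq_iff)
  have "pexp (flip_pair (1/2)) (insert i I) (\<lambda>w. H (fst_pt (insert i I) w) (snd_pt (insert i I) w)) =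
      pexp (flip_pair (1/2)) I (\<lambda>w. K (fst_pt I w) (snd_pt I w))"
    unfolding pexp_insert[OF insert.hyps] upd K_def
    by (simp add: sum_bit_pair sum_bit coin_def algebra_simps)
  also have "\<dots> = pexp coin I (\<lambda>x. pexp coin I (K x))" by (rule insert.IH)
  also have "\<dots> = pexp coin (insert i I) (\<lambda>x. pexp coin (insert i I) (H x))"
    unfolding pexp_insert[OF insert.hyps] K_def by (simp add: pexp_sum pexp_cmult pexp_add sum_bit)
  finally show ?case .
qed

lemma pexp_coin_indicator:
  assumes "finite I" "B \<subseteq> I \<rightarrow>\<^sub>E UNIV"
  shows "pexp coin I (indicator B) = card B / 2 ^ card I"
proof -
  have fin: "finite (I \<rightarrow>\<^sub>E (UNIV :: bit set))" using assms by (intro finite_PiE) auto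
  have "pexp coin I (indicator B) = (\<Sum>x\<in>I \<rightarrow>\<^sub>E UNIV. indicator B x / 2 ^ card I)"
    unfolding pexp_def coin_def by (simp add: power_one_over)
  also have "\<dots> = card B / 2 ^ card I"
    using fin assms(2) by (simp add: sum_divide_distrib[symmetric] sum.If_cases indicator_def Int_absorb1)
  finally show ?thesis .
qed

text \<open>Poincare inequality. Each nonempty set counts at least once in the total influence, and
  the influence of \<open>i\<close> is the mean square of half the difference in direction
  \<open>i\<close>, hence at most 1/4.\<close>

lemma variance_le:
  fixes \<phi> :: "('i \<Rightarrow> bit) \<Rightarrow> real"
  assumes I: "finite I"
    and lip: "\<And>x i. x \<in> I \<rightarrow>\<^sub>E UNIV \<Longrightarrow> i \<in> I \<Longrightarrow> \<bar>\<phi> (x(i := 0)) - \<phi> (x(i := 1))\<bar> \<le> 1"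
  shows "pexp coin I (\<lambda>x. (\<phi> x - pexp coin I \<phi>)\<^sup>2) \<le> card I / 4"
proof -
  obtain a where "\<forall>x\<in>I \<rightarrow>\<^sub>E UNIV. \<phi> x = mlin a I (\<lambda>i. bsign (x i))"
    using walsh_expansion[OF I] by blast
  then have \<phi>: "\<phi> x = mlin a I (\<lambda>i. bsign (x i))" if "x \<in> I \<rightarrow>\<^sub>E UNIV" for x using that by blast
  have mean: "pexp coin I \<phi> = a {}"
    using walsh_coeff[OF I, of "{}" a] \<phi> by (simp cong: pexp_cong)
  \<comment> \<open>Dropping the constant coefficient subtracts the mean.\<close>
  define b where "b = (\<lambda>S. if S = {} then 0 else a S)"
  have b: "mlin b I z = mlin a I z - a {}" for z
  proof -
    have "mlin (\<lambda>S. if S = {} then a {} else 0) I z = a {}"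
      using I by (simp add: mlin_def if_distrib[of "\<lambda>u. u * _"] sum.delta cong: if_cong)
    moreover have "b = (\<lambda>S. a S - (if S = {} then a {} else 0))" by (auto simp: b_def)
    ultimately show ?thesis by (simp add: mlin_diff)
  qed
  have "pexp coin I (\<lambda>x. (\<phi> x - pexp coin I \<phi>)\<^sup>2) = pexp coin I (\<lambda>x. (mlin b I (\<lambda>i. bsign (x i)))\<^sup>2)"
    unfolding mean b by (intro pexp_cong) (simp add: \<phi>)
  also have "\<dots> = (\<Sum>S\<in>Pow I. (b S)\<^sup>2)" by (rule pexp_coin_mlin_square[OF I])
  also have "\<dots> \<le> (\<Sum>S\<in>Pow I. real (card S) * (a S)\<^sup>2)"
  proof (intro sum_mono)
    fix S assume "S \<in> Pow I"
    then have "S = {} \<or> 1 \<le> card S" using I by (auto simp: Suc_le_eq card_gt_0_iff finite_subset)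
    then show "(b S)\<^sup>2 \<le> real (card S) * (a S)\<^sup>2"
      using mult_right_mono[of 1 "real (card S)" "(a S)\<^sup>2"] by (auto simp: b_def)
  qed
  also have "\<dots> = (\<Sum>i\<in>I. coord_weight I a i)" by (rule sum_coord_weight[OF I, symmetric])
  also have "\<dots> \<le> (\<Sum>i\<in>I. 1 / 4)"
  proof (rule sum_mono)
    fix i assume i: "i \<in> I"
    define J where "J = I - {i}"
    have J: "finite J" "i \<notin> J" "I = insert i J" using I i by (auto simp: J_def)
    let ?B = "\<lambda>x. mlin (\<lambda>S. a (insert i S)) J (\<lambda>i. bsign (x i))"
    have "(?B x)\<^sup>2 \<le> 1 / 4" if x: "x \<in> J \<rightarrow>\<^sub>E UNIV" for x
    proof -
      have mem: "x(i := c) \<in> I \<rightarrow>\<^sub>E UNIV" for c using x J by (auto simp: PiE_iff extensional_def)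
      have upd: "mlin d J (\<lambda>j. bsign ((x(i := c)) j)) = mlin d J (\<lambda>j. bsign (x j))" for d c
        using J(2) by (intro mlin_cong) auto
      have "\<phi> (x(i := c)) = mlin a J (\<lambda>j. bsign (x j)) + bsign c * ?B x" for c
        unfolding \<phi>[OF mem] unfolding J(3) mlin_insert[OF J(1,2)] upd by simp
      then have "\<phi> (x(i := 0)) - \<phi> (x(i := 1)) = 2 * ?B x" by simp
      moreover have "\<bar>\<phi> ((x(i := 0))(i := 0)) - \<phi> ((x(i := 0))(i := 1))\<bar> \<le> 1"
        by (rule lip[OF mem i])
      ultimately have "\<bar>?B x\<bar> \<le> 1 / 2" by simp
      then show ?thesis using abs_le_square_iff[of "?B x" "1 / 2"] by (simp add: power2_eq_square)
    qed
    then have "pexp coin J (\<lambda>x. (?B x)\<^sup>2) \<le> pexp coin J (\<lambda>_. 1 / 4)"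
      by (rule pexp_mono[OF prob_weight_coin])
    then show "coord_weight I a i \<le> 1 / 4"
      unfolding pexp_coin_mlin_square[OF J(1)] pexp_const[OF prob_weight_coin J(1)]
        J(3) coord_weight_insert[OF J(1,2)] .
  qed
  finally show ?thesis by simp
qed

text \<open>On \<open>B\<close>, which has measure at least 1/2, the deviation from the mean is the
  mean itself. Half of the squared mean is therefore bounded by the variance.\<close>

lemma mean_le_sqrt:
  fixes \<phi> :: "('i \<Rightarrow> bit) \<Rightarrow> real"
  assumes I: "finite I"
    and lip: "\<And>x i. x \<in> I \<rightarrow>\<^sub>E UNIV \<Longrightarrow> i \<in> I \<Longrightarrow> \<bar>\<phi> (x(i := 0)) - \<phi> (x(i := 1))\<bar> \<le> 1"
    and B: "B \<subseteq> I \<rightarrow>\<^sub>E UNIV" "2 ^ card I \<le> 2 * real (card B)" "\<And>x. x \<in> B \<Longrightarrow> \<phi> x = 0"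
  shows "pexp coin I \<phi> \<le> sqrt (card I)"
proof -
  define \<mu> where "\<mu> = pexp coin I \<phi>"
  have "1 / 2 \<le> card B / 2 ^ card I" using B(2) by (simp add: field_simps)
  then have "\<mu>\<^sup>2 * (1 / 2) \<le> \<mu>\<^sup>2 * pexp coin I (indicator B)"
    unfolding pexp_coin_indicator[OF I B(1)] by (intro mult_left_mono) auto
  also have "\<dots> = pexp coin I (\<lambda>x. \<mu>\<^sup>2 * indicator B x)" by (rule pexp_cmult[symmetric])
  also have "\<dots> \<le> pexp coin I (\<lambda>x. (\<phi> x - \<mu>)\<^sup>2)"
    using B(3) by (intro pexp_mono prob_weight_coin) (auto simp: indicator_def)
  also have "\<dots> \<le> card I / 4" unfolding \<mu>_def by (rule variance_le[OF I lip])
  finally have "\<mu>\<^sup>2 \<le> card I" by simp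
  then show ?thesis unfolding \<mu>_def by (rule real_le_rsqrt)
qed

lemma finite_cube: "finite (cube k)"
  unfolding cube_def by (intro finite_PiE) auto

lemma card_cube: "card (cube k) = 2 ^ k"
  by (simp add: cube_def card_PiE UNIV_bit numeral_2_eq_2)

lemma hamming_eq_sum: "real (hamming k x y) = (\<Sum>i\<in>{1..k}. if x i = y i then 0 else 1)"
proof -
  have "{1..k} \<inter> - {i. x i = y i} = {j \<in> {1..k}. x j \<noteq> y j}" by auto
  then show ?thesis by (simp add: hamming_def sum.If_cases)
qed

lemma hamming_commute: "hamming k x y = hamming k y x"
  unfolding hamming_def by (rule arg_cong[of _ _ card]) auto

lemma hamming_triangle: "hamming k x z \<le> hamming k x y + hamming k y z"
proof -
  have "hamming k x z \<le> card ({j \<in> {1..k}. x j \<noteq> y j} \<union> {j \<in> {1..k}. y j \<noteq> z j})"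
    unfolding hamming_def by (intro card_mono) auto
  then show ?thesis unfolding hamming_def using card_Un_le order_trans by blast
qed

lemma hamming_fun_upd_le: "hamming k (x(i := a)) (x(i := b)) \<le> 1"
proof -
  have "hamming k (x(i := a)) (x(i := b)) \<le> card {i}"
    unfolding hamming_def by (intro card_mono) auto
  then show ?thesis by simp
qed

lemma mean_hamming:
  assumes "0 \<le> t" "t \<le> 1"
  shows "pexp (flip_pair t) {1..k} (\<lambda>w. real (hamming k (fst_pt {1..k} w) (snd_pt {1..k} w))) = t * k"
proof -
  have "pexp (flip_pair t) {1..k} (\<lambda>w. real (hamming k (fst_pt {1..k} w) (snd_pt {1..k} w))) =
      (\<Sum>i\<in>{1..k}. pexp (flip_pair t) {1..k} (\<lambda>w. if fst (w i) = snd (w i) then 0 else 1))"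
    unfolding pexp_sum[symmetric] hamming_eq_sum by (intro pexp_cong sum.cong) auto
  also have "\<dots> = (\<Sum>i\<in>{1..k}. t)"
  proof (intro sum.cong refl)
    fix i assume "i \<in> {1..k}"
    then show "pexp (flip_pair t) {1..k} (\<lambda>w. if fst (w i) = snd (w i) then 0 else 1) = t"
      using pexp_coord[OF prob_weight_flip_pair[OF assms], of "{1..k}" i "\<lambda>c. if fst c = snd c then 0 else 1"]
      by (simp add: sum_bit_pair)
  qed
  finally show ?thesis by simp
qed

text \<open>Chernoff's method with the weight \<open>1/32\<close> per differing coordinate.\<close>

lemma small_ball:
  "pexp coin {1..k} (\<lambda>y. if real (hamming k x y) < k / 50 then 1 else 0) \<le> 2 powr (- (17 / 20) * k)"
proof -
  \<comment> \<open>A differing coordinate costs \<open>2 powr - 5\<close>; fewer than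
    \<open>k / 50\<close> of them cost less than the prefactor \<open>2 powr (k / 10)\<close>
    returns.\<close>
  have "pexp coin {1..k} (\<lambda>y. if real (hamming k x y) < k / 50 then 1 else 0) \<le>
      pexp coin {1..k} (\<lambda>y. 2 powr (k / 10) * (\<Prod>i\<in>{1..k}. if x i = y i then 1 else 1 / 32))"
  proof (rule pexp_mono[OF prob_weight_coin])
    fix y :: "nat \<Rightarrow> bit"
    have "{1..k} \<inter> - {i. x i = y i} = {j \<in> {1..k}. x j \<noteq> y j}" by auto
    then have "(\<Prod>i\<in>{1..k}. if x i = y i then 1 else 1 / 32) = (1 / 32 :: real) ^ hamming k x y"
      by (simp add: hamming_def prod.If_cases)
    also have "\<dots> = (2 powr (- 5)) ^ hamming k x y" by (simp add: powr_minus powr_numeral)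
    also have "\<dots> = (2 powr (- 5)) powr real (hamming k x y)" by (rule powr_realpow[symmetric]) simp
    also have "\<dots> = 2 powr (- 5 * real (hamming k x y))" by (rule powr_powr)
    finally have "2 powr (k / 10) * (\<Prod>i\<in>{1..k}. if x i = y i then 1 else 1 / 32 :: real) =
        2 powr (k / 10 + - 5 * real (hamming k x y))"
      by (simp only: powr_add)
    moreover have "1 \<le> (2::real) powr (k / 10 + - 5 * real (hamming k x y))" if "real (hamming k x y) < k / 50"
      using that by (intro ge_one_powr_ge_zero) auto
    ultimately show "(if real (hamming k x y) < k / 50 then 1 else 0) \<le>
        2 powr (k / 10) * (\<Prod>i\<in>{1..k}. if x i = y i then 1 else 1 / 32 :: real)"
      by auto
  qed
  also have "\<dots> = 2 powr (k / 10) * (\<Prod>i\<in>{1..k}. 33 / 64)"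
  proof -
    have eq: "(\<Sum>b\<in>UNIV. coin b * (if x i = b then 1 else 1 / 32)) = 33 / 64" for i
      by (cases "x i") (simp_all add: sum_bit coin_def)
    show ?thesis
      unfolding pexp_cmult eq
        pexp_prod[OF finite_atLeastAtMost, where F = "\<lambda>i b. if x i = b then 1 else 1 / 32"] ..
  qed
  also have "\<dots> = 2 powr (k / 10) * (33 / 64) powr k" by (simp add: powr_realpow)
  \<comment> \<open>\<open>33/64\<close> is the mean weight of one coordinate. It slightly exceeds
    1/2, and comparing twentieth powers puts it below \<open>2 powr (- 19 / 20)\<close>.\<close>
  also have "\<dots> \<le> 2 powr (k / 10) * (2 powr (- 19 / 20)) powr k"
  proof -
    have "(2 powr (- 19 / 20)) ^ 20 = (2 powr (- 19 / 20) :: real) powr real 20"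
      by (rule powr_realpow[symmetric]) simp
    also have "\<dots> = 2 powr (- 19)" unfolding powr_powr by simp
    also have "\<dots> = 1 / 2 ^ 19" by (simp add: powr_minus powr_numeral)
    finally have "(33 / 64 :: real) ^ 20 \<le> (2 powr (- 19 / 20)) ^ 20" by (simp add: power_divide)
    then have "(33 / 64 :: real) \<le> 2 powr (- 19 / 20)" by (subst (asm) power_mono_iff) auto
    then show ?thesis by (intro mult_left_mono powr_mono2) auto
  qed
  also have "\<dots> = 2 powr (- (17 / 20) * k)" by (simp add: powr_powr powr_add[symmetric])
  finally show ?thesis .
qed

section \<open>The quotient metric\<close>

lemma sym_group_subgroup:
  assumes G: "subgroup G (sym_group k)"
  shows "g \<in> G \<Longrightarrow> g permutes {1..k}" "g \<in> G \<Longrightarrow> h \<in> G \<Longrightarrow> g \<circ> h \<in> G"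
    "g \<in> G \<Longrightarrow> inv' g \<in> G" "id \<in> G" "finite G"
proof -
  show perm: "g permutes {1..k}" if "g \<in> G" for g
    using subgroup.subset[OF G] that by (auto simp: sym_group_def)
  show "g \<circ> h \<in> G" if "g \<in> G" "h \<in> G"
    using subgroup.m_closed[OF G that] by (simp add: sym_group_def)
  show "inv' g \<in> G" if "g \<in> G"
  proof -
    have "g \<in> carrier (sym_group k)" using perm[OF that] by (simp add: sym_group_def)
    then show ?thesis using subgroup.m_inv_closed[OF G that] by simp
  qed
  show "id \<in> G" using subgroup.one_closed[OF G] by (simp add: sym_group_def)
  have "G \<subseteq> {p. p permutes {1..k}}" using perm by blast
  then show "finite G" by (rule finite_subset) (simp add: finite_permutations)
qed

lemma coord_action_id: "coord_action id x = x"
  by (simp add: coord_action_def)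

lemma coord_action_inv:
  assumes "g permutes {1..k}"
  shows "coord_action (inv' g) (coord_action g x) = x"
  using assms by (simp add: coord_action_comp[OF permutes_inv] permutes_inv_o coord_action_id)

lemma cube_orbit_eq: "cube_orbit k G x = (\<lambda>g. coord_action g x) ` G"
  by (auto simp: cube_orbit_def orbit_def)

lemma cube_orbit_coord_action:
  assumes G: "subgroup G (sym_group k)" and g: "g \<in> G"
  shows "cube_orbit k G (coord_action g x) = cube_orbit k G x"
proof -
  note G' = sym_group_subgroup[OF G]
  have sub: "cube_orbit k G (coord_action g x) \<subseteq> cube_orbit k G x" if "g \<in> G" for g x
  proof
    fix y assume "y \<in> cube_orbit k G (coord_action g x)"
    then obtain h where h: "h \<in> G" "y = coord_action h (coord_action g x)"
      by (auto simp: cube_orbit_eq)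
    then have "y = coord_action (h \<circ> g) x"
      using coord_action_comp[OF G'(1) G'(1)] that by simp
    then show "y \<in> cube_orbit k G x" using G'(2)[OF h(1) that] by (auto simp: cube_orbit_eq)
  qed
  have "cube_orbit k G (coord_action (inv' g) (coord_action g x)) \<subseteq> cube_orbit k G (coord_action g x)"
    by (rule sub[OF G'(3)[OF g]])
  then show ?thesis using sub[OF g] by (simp add: coord_action_inv[OF G'(1)[OF g]] equalityI)
qed

text \<open>The quotient metric pulled back to a pseudometric on points, so that Lipschitz and
  averaging arguments can run on the cube.\<close>

definition odist :: "nat \<Rightarrow> (nat \<Rightarrow> nat) set \<Rightarrow> (nat \<Rightarrow> bit) \<Rightarrow> (nat \<Rightarrow> bit) \<Rightarrow> nat" where
  "odist k G x y = orbit_dist k (cube_orbit k G x) (cube_orbit k G y)"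

context
  fixes k :: nat and G :: "(nat \<Rightarrow> nat) set"
  assumes G: "subgroup G (sym_group k)"
begin

lemma odist_le: "g \<in> G \<Longrightarrow> odist k G x y \<le> hamming k (coord_action g x) y"
  unfolding odist_def orbit_dist_cube_orbit[OF G] using sym_group_subgroup(5)[OF G] by simp

lemma odist_le_hamming: "odist k G x y \<le> hamming k x y"
  using odist_le[OF sym_group_subgroup(4)[OF G], of x y] by (simp add: coord_action_id)

lemma odist_attained: "\<exists>g\<in>G. odist k G x y = hamming k (coord_action g x) y"
proof -
  have "Min ((\<lambda>g. hamming k (coord_action g x) y) ` G) \<in> (\<lambda>g. hamming k (coord_action g x) y) ` G"
    using sym_group_subgroup(4,5)[OF G] by (intro Min_in) auto
  then show ?thesis unfolding odist_def orbit_dist_cube_orbit[OF G] by blast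
qed

lemma odist_self: "odist k G x x = 0"
  using odist_le_hamming[of x x] by (simp add: hamming_def)

lemma odist_commute: "odist k G x y = odist k G y x"
proof -
  have "odist k G y x \<le> odist k G x y" for x y
  proof -
    obtain g where g: "g \<in> G" "odist k G x y = hamming k (coord_action g x) y"
      using odist_attained by blast
    note g' = sym_group_subgroup(1,3)[OF G g(1)]
    have "odist k G y x \<le> hamming k (coord_action (inv' g) y) x" by (rule odist_le[OF g'(2)])
    also have "\<dots> = hamming k (coord_action (inv' g) y) (coord_action (inv' g) (coord_action g x))"
      by (simp add: coord_action_inv[OF g'(1)])
    also have "\<dots> = odist k G x y"
      by (simp add: hamming_coord_action[OF permutes_inv[OF g'(1)]] hamming_commute g(2))
    finally show ?thesis .
  qed
  then show ?thesis by (simp add: le_antisym)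
qed

text \<open>The optimal permutations of the two pairs are composed; the action is isometric.\<close>

lemma odist_triangle: "odist k G x z \<le> odist k G x y + odist k G y z"
proof -
  obtain g where g: "g \<in> G" "odist k G x y = hamming k (coord_action g x) y"
    using odist_attained by blast
  obtain h where h: "h \<in> G" "odist k G y z = hamming k (coord_action h y) z"
    using odist_attained by blast
  note p = sym_group_subgroup[OF G]
  have "odist k G x z \<le> hamming k (coord_action (h \<circ> g) x) z" by (rule odist_le[OF p(2)[OF h(1) g(1)]])
  also have "\<dots> = hamming k (coord_action h (coord_action g x)) z"
    by (simp add: coord_action_comp[OF p(1)[OF h(1)] p(1)[OF g(1)]])
  also have "\<dots> \<le> hamming k (coord_action h (coord_action g x)) (coord_action h y) + hamming k (coord_action h y) z"
    by (rule hamming_triangle)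
  finally show ?thesis using g h by (simp add: hamming_coord_action[OF p(1)[OF h(1)]])
qed

text \<open>Composing a point with \<open>g\<close> is the action of the inverse of
  \<open>g\<close>, which does not leave the orbit.\<close>

lemma transitively_symmetric_orbit_function:
  assumes "transitive_perms k G"
  shows "transitively_symmetric {1..k} (\<lambda>x. F (cube_orbit k G x))"
  unfolding transitively_symmetric_def
proof (intro ballI)
  fix i j assume "i \<in> {1..k}" "j \<in> {1..k}"
  then obtain g where g: "g \<in> G" "g i = j" using assms unfolding transitive_perms_def by blast
  note p = sym_group_subgroup[OF G]
  have "x \<circ> g = coord_action (inv' g) x" for x :: "nat \<Rightarrow> bit"
    by (simp add: coord_action_def fun_eq_iff inv_inv_eq[OF permutes_bij[OF p(1)[OF g(1)]]])
  then show "\<exists>h. h permutes {1..k} \<and> h i = j \<and>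
      (\<forall>x\<in>{1..k} \<rightarrow>\<^sub>E UNIV. F (cube_orbit k G (x \<circ> h)) = F (cube_orbit k G x))"
    using g p(1) cube_orbit_coord_action[OF G p(3)] by (intro exI[of _ g]) simp
qed


text \<open>It serves to extend maps from the quotient of \<open>M\<close> to the whole cube. The
  minimised function depends on \<open>x\<close> only through its orbit, hence so does the chosen
  point, and the extension remains invariant.\<close>

definition nearest :: "(nat \<Rightarrow> bit) set \<Rightarrow> (nat \<Rightarrow> bit) \<Rightarrow> nat \<Rightarrow> bit" where
  "nearest M x = arg_min_on (odist k G x) M"

lemma nearest:
  assumes "finite M" "M \<noteq> {}"
  shows "nearest M x \<in> M" and "z \<in> M \<Longrightarrow> odist k G x (nearest M x) \<le> odist k G x z"
  unfolding nearest_def using arg_min_if_finite[OF assms, of "odist k G x"]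
  by (auto simp: not_less)

lemma odist_nearest_le:
  assumes "finite M" "M \<noteq> {}"
  shows "odist k G x (nearest M x) \<le> hamming k x y + odist k G y (nearest M y)"
proof -
  have "odist k G x (nearest M x) \<le> odist k G x (nearest M y)" using nearest[OF assms] by blast
  also have "\<dots> \<le> odist k G x y + odist k G y (nearest M y)" by (rule odist_triangle)
  finally show ?thesis using odist_le_hamming[of x y] by linarith
qed

text \<open>The distance to the orbits of \<open>M\<close> changes by at most 1 per coordinate and
  vanishes on \<open>M\<close>, which fills at least half of the cube.\<close>

lemma mean_odist_nearest_le:
  assumes M: "M \<subseteq> cube k" and big: "2 ^ k \<le> 2 * real (card M)"
  shows "pexp coin {1..k} (\<lambda>x. real (odist k G x (nearest M x))) \<le> sqrt k"
proof -
  have "(0::real) < 2 ^ k" by simp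
  then have "0 < real (card M)" using big by linarith
  then have M': "finite M" "M \<noteq> {}" by (auto simp: card_gt_0_iff)
  have "pexp coin {1..k} (\<lambda>x. real (odist k G x (nearest M x))) \<le> sqrt (card {1..k})"
  proof (rule mean_le_sqrt[where B = M])
    fix x :: "nat \<Rightarrow> bit" and i
    have "odist k G (x(i := 0)) (nearest M (x(i := 0))) \<le> 1 + odist k G (x(i := 1)) (nearest M (x(i := 1)))"
      "odist k G (x(i := 1)) (nearest M (x(i := 1))) \<le> 1 + odist k G (x(i := 0)) (nearest M (x(i := 0)))"
      using odist_nearest_le[OF M', of "x(i := 0)" "x(i := 1)"] odist_nearest_le[OF M', of "x(i := 1)" "x(i := 0)"]
        hamming_fun_upd_le[of k x i 0 1] hamming_fun_upd_le[of k x i 1 0] by linarith+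
    then show "\<bar>real (odist k G (x(i := 0)) (nearest M (x(i := 0)))) -
        real (odist k G (x(i := 1)) (nearest M (x(i := 1))))\<bar> \<le> 1" by linarith
  next
    fix x assume "x \<in> M"
    then show "real (odist k G x (nearest M x)) = 0"
      using nearest(2)[OF M', of x x] odist_self[of x] by simp
  qed (use M big in \<open>auto simp: cube_def\<close>)
  then show ?thesis by simp
qed

text \<open>Union bound: each endpoint misses \<open>M\<close> with probability at most 1/4. The
  \<open>card G\<close> small balls together have measure at most
  \<open>2 powr (- (7 / 20) * k)\<close>, again at most 1/4 once \<open>k \<ge> 6\<close>. So a
  quarter of all pairs is far apart.\<close>

lemma most_pairs_far:
  assumes M: "M \<subseteq> cube k" and M4: "real (card (cube k - M)) \<le> 2 ^ k / 4"
    and card: "real (card G) \<le> 2 powr (real k / 2)" and k: "k \<ge> 6" and e: "0 < e"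
  shows "(k / 50) powr e / 4 \<le> pexp (flip_pair (1/2)) {1..k}
    (\<lambda>w. real (odist k G (nearest M (fst_pt {1..k} w)) (nearest M (snd_pt {1..k} w))) powr e)"
proof -
  let ?I = "{1..k}" and ?p = "flip_pair (1/2)"
  have p: "prob_weight ?p" by (rule prob_weight_flip_pair) auto
  have cube: "cube k = ?I \<rightarrow>\<^sub>E UNIV" by (simp add: cube_def)
  have M': "finite M" using M finite_cube finite_subset by blast
  define B where "B = (\<lambda>x y. if real (hamming k x y) < k / 50 then 1 else 0 :: real)"
  \<comment> \<open>A lower bound for the indicator of the event that both points lie in
    \<open>M\<close> at quotient distance at least \<open>k / 50\<close>.\<close>
  define C where "C = (\<lambda>x y. 1 - indicator (cube k - M) x - indicator (cube k - M) y -
      (\<Sum>g\<in>G. B (coord_action g x) y) :: real)"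
  have small: "pexp coin ?I (indicator (cube k - M)) \<le> 1 / 4"
    using M4 by (subst pexp_coin_indicator) (auto simp: cube field_simps)
  have ball: "pexp ?p ?I (\<lambda>w. \<Sum>g\<in>G. B (coord_action g (fst_pt ?I w)) (snd_pt ?I w)) \<le> 1 / 4"
  proof -
    have "pexp ?p ?I (\<lambda>w. \<Sum>g\<in>G. B (coord_action g (fst_pt ?I w)) (snd_pt ?I w)) =
        pexp coin ?I (\<lambda>x. \<Sum>g\<in>G. pexp coin ?I (B (coord_action g x)))"
      by (subst pexp_independent[where H = "\<lambda>x y. \<Sum>g\<in>G. B (coord_action g x) y"]) (simp_all add: pexp_sum)
    also have "\<dots> \<le> pexp coin ?I (\<lambda>x. \<Sum>g\<in>G. 2 powr (- (17 / 20) * k))"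
      unfolding B_def by (intro pexp_mono[OF prob_weight_coin] sum_mono small_ball)
    also have "\<dots> = card G * 2 powr (- (17 / 20) * k)"
      by (simp add: pexp_const[OF prob_weight_coin])
    also have "\<dots> \<le> 2 powr (real k / 2) * 2 powr (- (17 / 20) * k)"
      using card by (intro mult_right_mono) auto
    also have "\<dots> = 2 powr (- (7 / 20) * k)" by (simp flip: powr_add)
    also have "\<dots> \<le> 2 powr (- 2)" using k by (intro powr_mono) auto
    also have "\<dots> = 1 / 4" by (simp add: powr_minus)
    finally show ?thesis .
  qed
  have "1 / 4 \<le> pexp ?p ?I (\<lambda>w. C (fst_pt ?I w) (snd_pt ?I w))"
    unfolding C_def pexp_diff pexp_const[OF p finite_atLeastAtMost]
      pexp_fst_pt[OF finite_atLeastAtMost] pexp_snd_pt[OF finite_atLeastAtMost]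
    using small ball by linarith
  then have "(k / 50) powr e * (1 / 4) \<le> (k / 50) powr e * pexp ?p ?I (\<lambda>w. C (fst_pt ?I w) (snd_pt ?I w))"
    by (intro mult_left_mono) auto
  also have "\<dots> \<le> pexp ?p ?I
    (\<lambda>w. real (odist k G (nearest M (fst_pt ?I w)) (nearest M (snd_pt ?I w))) powr e)"
    unfolding pexp_cmult[symmetric]
  proof (rule pexp_mono[OF p])
    fix w :: "nat \<Rightarrow> bit \<times> bit"
    define x y where "x = fst_pt ?I w" and "y = snd_pt ?I w"
    have xy: "x \<in> cube k" "y \<in> cube k" by (auto simp: x_def y_def cube)
    have B0: "B u v \<ge> 0" for u v by (simp add: B_def)
    have S0: "0 \<le> (\<Sum>g\<in>G. B (coord_action g x) y)" using B0 by (rule sum_nonneg)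
    have "(k / 50) powr e * C x y \<le> real (odist k G (nearest M x) (nearest M y)) powr e"
    proof (cases "x \<in> M \<and> y \<in> M \<and> k / 50 \<le> odist k G x y")
      case True
      then have ne: "M \<noteq> {}" by blast
      have z: "odist k G x (nearest M x) = 0" "odist k G y (nearest M y) = 0"
        using True nearest(2)[OF M' ne, of x x] nearest(2)[OF M' ne, of y y] odist_self by simp_all
      have "odist k G x y \<le> odist k G x (nearest M x) + odist k G (nearest M x) y"
        by (rule odist_triangle)
      also have "odist k G (nearest M x) y \<le> odist k G (nearest M x) (nearest M y) + odist k G (nearest M y) y"
        by (rule odist_triangle)
      finally have "odist k G x y \<le> odist k G (nearest M x) (nearest M y)"
        using z by (simp add: odist_commute[of "nearest M y"])
      then have "k / 50 \<le> real (odist k G (nearest M x) (nearest M y))" using True by linarith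
      then have "(k / 50) powr e \<le> real (odist k G (nearest M x) (nearest M y)) powr e"
        using e by (intro powr_mono2) auto
      moreover have "C x y \<le> 1"
        using True S0 by (simp add: C_def)
      ultimately show ?thesis using mult_left_mono[of "C x y" 1 "(k / 50) powr e"] by simp
    next
      case False
      have "C x y \<le> 0"
      proof (cases "x \<in> M \<and> y \<in> M")
        case True
        then have far: "odist k G x y < k / 50" using False by simp
        obtain g where g: "g \<in> G" "odist k G x y = hamming k (coord_action g x) y"
          using odist_attained by blast
        have "B (coord_action g x) y \<le> (\<Sum>g\<in>G. B (coord_action g x) y)"
          using g(1) sym_group_subgroup(5)[OF G] B0 by (intro member_le_sum) auto
        moreover have "B (coord_action g x) y = 1" using far g(2) by (simp add: B_def)
        ultimately show ?thesis using True by (simp add: C_def)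
      next
        case False
        then have "1 \<le> indicator (cube k - M) x + (indicator (cube k - M) y :: real)"
          using xy by (auto simp: indicator_def)
        then show ?thesis using S0 by (simp add: C_def)
      qed
      then show ?thesis by (simp add: mult_nonneg_nonpos order_trans[of _ 0])
    qed
    then show "(k / 50) powr e * C (fst_pt ?I w) (snd_pt ?I w) \<le>
        real (odist k G (nearest M (fst_pt ?I w)) (nearest M (snd_pt ?I w))) powr e"
      by (simp add: x_def y_def)
  qed
  finally show ?thesis by simp
qed

text \<open>A substitute for Jensen's inequality: the mean of the power is controlled by the mean of
  \<open>X\<close>, at the price of a factor 2 when that mean is at most \<open>T\<close>.\<close>

lemma powr_le_linear:
  fixes X T e :: real
  assumes "0 \<le> X" "0 < T" "0 < e" "e \<le> 1"
  shows "X powr e \<le> T powr e * (1 + X / T)"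
proof -
  have "(X / T) powr e \<le> 1 + X / T"
  proof (cases "X / T \<le> 1")
    case True
    then have "(X / T) powr e \<le> 1 powr e" using assms by (intro powr_mono2) auto
    then show ?thesis using assms by (simp add: add_increasing2)
  next
    case False
    then have "(X / T) powr e \<le> (X / T) powr 1" using assms by (intro powr_mono) auto
    then show ?thesis using assms by simp
  qed
  then have "T powr e * (X / T) powr e \<le> T powr e * (1 + X / T)" by (intro mult_left_mono) auto
  moreover have "T powr e * (X / T) powr e = X powr e"
    using assms by (simp flip: powr_mult)
  ultimately show ?thesis by simp
qed

text \<open>The triangle inequality through \<open>x\<close> and \<open>y\<close> bounds the
  distance by two projection errors, of mean at most \<open>sqrt k\<close> each, plus the number of
  flips, of mean \<open>t * k\<close>.\<close>

lemma noisy_pairs_close: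
  fixes t T e :: real
  assumes M: "M \<subseteq> cube k" and big: "2 ^ k \<le> 2 * real (card M)"
    and t: "0 \<le> t" "t \<le> 1" and e: "0 < e" "e \<le> 1"
    and T: "0 < T" "2 * sqrt k + t * k \<le> T"
  shows "pexp (flip_pair t) {1..k}
    (\<lambda>w. real (odist k G (nearest M (fst_pt {1..k} w)) (nearest M (snd_pt {1..k} w))) powr e) \<le> 2 * T powr e"
proof -
  let ?I = "{1..k}" and ?p = "flip_pair t" and ?\<phi> = "\<lambda>x. real (odist k G x (nearest M x))"
  have p: "prob_weight ?p" by (rule prob_weight_flip_pair[OF t])
  define X where "X = (\<lambda>w. ?\<phi> (fst_pt ?I w) + real (hamming k (fst_pt ?I w) (snd_pt ?I w)) + ?\<phi> (snd_pt ?I w))"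
  have "pexp ?p ?I (\<lambda>w. real (odist k G (nearest M (fst_pt ?I w)) (nearest M (snd_pt ?I w))) powr e)
      \<le> pexp ?p ?I (\<lambda>w. T powr e * (1 + 1 / T * X w))"
  proof (rule pexp_mono[OF p])
    fix w :: "nat \<Rightarrow> bit \<times> bit"
    define x y where "x = fst_pt ?I w" and "y = snd_pt ?I w"
    have "odist k G (nearest M x) (nearest M y) \<le> odist k G (nearest M x) x + odist k G x (nearest M y)"
      by (rule odist_triangle)
    also have "odist k G x (nearest M y) \<le> odist k G x y + odist k G y (nearest M y)"
      by (rule odist_triangle)
    finally have "real (odist k G (nearest M x) (nearest M y)) \<le> X w"
      using odist_le_hamming[of x y] odist_commute[of "nearest M x" x]
      unfolding X_def x_def[symmetric] y_def[symmetric] by linarith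
    then have "real (odist k G (nearest M x) (nearest M y)) powr e \<le> X w powr e"
      using e by (intro powr_mono2) auto
    also have "\<dots> \<le> T powr e * (1 + X w / T)"
      by (rule powr_le_linear) (use T e in \<open>auto simp: X_def\<close>)
    finally show "real (odist k G (nearest M (fst_pt ?I w)) (nearest M (snd_pt ?I w))) powr e \<le>
        T powr e * (1 + 1 / T * X w)"
      by (simp add: x_def y_def)
  qed
  also have "\<dots> = T powr e * (1 + 1 / T * (pexp coin ?I ?\<phi> + t * k + pexp coin ?I ?\<phi>))"
    unfolding pexp_cmult pexp_add pexp_const[OF p finite_atLeastAtMost] X_def mean_hamming[OF t]
      pexp_fst_pt[OF finite_atLeastAtMost, where F = ?\<phi>] pexp_snd_pt[OF finite_atLeastAtMost, where F = ?\<phi>] ..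
  also have "\<dots> \<le> T powr e * (1 + 1 / T * T)"
    using mean_odist_nearest_le[OF M big] T
    by (intro mult_left_mono add_left_mono) auto
  finally show ?thesis using T by simp
qed

text \<open>Independent pairs have typical distance of order \<open>k\<close>, noisy ones of order
  \<open>k / m^2\<close>, while the L1 averages differ by a factor of order \<open>m\<close> at
  most. So \<open>m powr (2 * e)\<close> is at most of order \<open>m * \<alpha>\<close>.\<close>

lemma distortion_lower_bound:
  assumes trans: "transitive_perms k G" and card: "real (card G) \<le> 2 powr (real k / 2)"
    and M: "M \<subseteq> cube k" and M4: "real (card (cube k - M)) \<le> 2 ^ k / 4"
    and m: "m \<ge> 1" and big: "5000 * real m ^ 5 * 81 ^ m\<^sup>2 \<le> k"
    and e: "1 / 2 < e" "e < 1"
    and emb: "embeds_L1 \<mu> (cube_orbit k G ` M) (\<lambda>A B. real (orbit_dist k A B) powr e) \<alpha>"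
    and \<alpha>: "\<alpha> \<ge> 1"
  shows "real m powr (2 * e - 1) \<le> 67200 * \<alpha>"
proof -
  let ?I = "{1..k}"
  let ?\<nu> = "nearest M"
  define t where "t = (1 - cos (pi / (2 * real m))) / 2"
  from emb[unfolded embeds_L1_def] obtain f s where s: "s > 0"
    and int: "\<forall>x\<in>cube_orbit k G ` M. integrable \<mu> (f x)"
    and f: "\<forall>x\<in>cube_orbit k G ` M. \<forall>y\<in>cube_orbit k G ` M.
      s * real (orbit_dist k x y) powr e \<le> (\<integral>\<omega>. \<bar>f x \<omega> - f y \<omega>\<bar> \<partial>\<mu>) \<and>
      (\<integral>\<omega>. \<bar>f x \<omega> - f y \<omega>\<bar> \<partial>\<mu>) \<le> \<alpha> * s * real (orbit_dist k x y) powr e"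
    by (elim exE conjE)
  define F where "F = (\<lambda>x. f (cube_orbit k G (?\<nu> x)))"
  define N where "N = (\<lambda>w. \<integral>\<omega>. \<bar>F (fst_pt ?I w) \<omega> - F (snd_pt ?I w) \<omega>\<bar> \<partial>\<mu>)"
  define X where "X = (\<lambda>w. real (odist k G (?\<nu> (fst_pt ?I w)) (?\<nu> (snd_pt ?I w))) powr e)"
  have m1: "real m \<ge> 1" using m by simp
  have k5: "real k \<ge> 5000 * real m ^ 4"
  proof -
    have "(1::real) \<le> 81 ^ m\<^sup>2" by simp
    then have "1 * 1 \<le> real m * 81 ^ m\<^sup>2" using m1 by (intro mult_mono) auto
    then have "5000 * real m ^ 4 * 1 \<le> 5000 * real m ^ 4 * (real m * 81 ^ m\<^sup>2)"
      by (intro mult_left_mono) auto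
    also have "\<dots> = 5000 * (real m ^ 4 * real m) * 81 ^ m\<^sup>2" by (simp only: mult.assoc)
    also have "real m ^ 4 * real m = real m ^ 5" by (simp only: power_Suc2[symmetric]) simp
    finally show ?thesis using big by linarith
  qed
  have m4: "1 \<le> real m ^ 4" using m1 by (rule one_le_power)
  have k6: "k \<ge> 6" using k5 m4 by simp
  have "card M + card (cube k - M) = 2 ^ k"
    using card_Un_disjoint[of M "cube k - M"] M finite_cube[of k] finite_subset[OF M finite_cube]
    by (simp add: card_cube Un_absorb1)
  then have "real (card M) + real (card (cube k - M)) = 2 ^ k"
    by (metis of_nat_add of_nat_numeral of_nat_power)
  then have half: "2 ^ k \<le> 2 * real (card M)" using M4 by simp
  have "(0::real) < 2 ^ k" by simp
  then have "0 < real (card M)" using half by linarith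
  then have M': "finite M" "M \<noteq> {}" by (auto simp: card_gt_0_iff)
  note \<nu> = nearest(1)[OF M']
  have NX: "s * X w \<le> N w" "N w \<le> \<alpha> * s * X w" for w
    using bspec[OF bspec[OF f imageI[OF \<nu>[of "fst_pt ?I w"]]] imageI[OF \<nu>[of "snd_pt ?I w"]]]
    unfolding N_def F_def X_def odist_def by blast+
  have symF: "transitively_symmetric ?I F"
  proof -
    \<comment> \<open>Written this way, \<open>F\<close> visibly factors through the orbit of its
      argument.\<close>
    have "F = (\<lambda>x. (\<lambda>A. f (cube_orbit k G (arg_min_on (\<lambda>z. orbit_dist k A (cube_orbit k G z)) M)))
        (cube_orbit k G x))"
      by (simp add: F_def nearest_def odist_def[abs_def])
    then show ?thesis using transitively_symmetric_orbit_function[OF trans] by simp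
  qed
  have tk: "0 \<le> t" "t \<le> 1" "t \<le> 1 / (real m)\<^sup>2"
  proof -
    let ?y = "pi / (4 * real m)"
    have "cos (2 * ?y) = 1 - 2 * (sin ?y)\<^sup>2" by (rule cos_double_sin)
    then have t: "t = (sin ?y)\<^sup>2" by (simp add: t_def)
    show "0 \<le> t" "t \<le> 1" unfolding t by (simp_all add: abs_square_le_1)
    have "\<bar>sin ?y\<bar> \<le> \<bar>?y\<bar>" by (rule abs_sin_x_le_abs_x)
    also have "\<dots> \<le> \<bar>1 / real m\<bar>" using pi_less_4 m1 by (simp add: field_simps)
    finally show "t \<le> 1 / (real m)\<^sup>2" unfolding t abs_le_square_iff by (simp add: power_one_over)
  qed
  \<comment> \<open>One share \<open>k / m^2\<close> pays for the flips and two pay for the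
    projections, as \<open>m^4 \<le> k\<close> gives \<open>sqrt k \<le> k / m^2\<close>.\<close>
  define T where "T = 3 * k / (real m)\<^sup>2"
  have T0: "T > 0" using m1 k6 by (simp add: T_def)
  have TT: "2 * sqrt k + t * k \<le> T"
  proof -
    have "real m ^ 4 \<le> k" using k5 m4 by linarith
    then have "((real m)\<^sup>2)\<^sup>2 \<le> k" by (simp flip: power_mult)
    then have "(real m)\<^sup>2 \<le> sqrt k" by (rule real_le_rsqrt)
    then have "sqrt k * (real m)\<^sup>2 \<le> sqrt k * sqrt k" by (intro mult_left_mono) auto
    then have "sqrt k \<le> k / (real m)\<^sup>2" using m1 by (simp add: le_divide_eq)
    moreover have "t * k \<le> 1 / (real m)\<^sup>2 * k" using tk by (intro mult_right_mono) auto
    ultimately show ?thesis by (simp add: T_def)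
  qed
  have "s * ((k / 50) powr e / 4) \<le> s * pexp (flip_pair (1/2)) ?I X"
    unfolding X_def using s e by (intro mult_left_mono most_pairs_far[OF M M4 card k6]) auto
  also have "\<dots> \<le> pexp (flip_pair (1/2)) ?I N"
    unfolding pexp_cmult[symmetric] by (intro pexp_mono prob_weight_flip_pair NX) auto
  also have "\<dots> \<le> 56 * real m * pexp (flip_pair t) ?I N"
    unfolding N_def
  proof (rule L1_noise[OF _ m _ symF])
    show "1 - 2 * t = cos (pi / (2 * real m))" by (simp add: t_def field_simps)
    show "integrable \<mu> (F x)" for x unfolding F_def using bspec[OF int imageI[OF \<nu>]] .
  qed (use big in auto)
  also have "\<dots> \<le> 56 * real m * (\<alpha> * s * (2 * T powr e))"
  proof (intro mult_left_mono)
    have "pexp (flip_pair t) ?I N \<le> \<alpha> * s * pexp (flip_pair t) ?I X"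
      unfolding pexp_cmult[symmetric] by (intro pexp_mono prob_weight_flip_pair NX tk)
    also have "\<dots> \<le> \<alpha> * s * (2 * T powr e)"
      unfolding X_def using \<alpha> s e
      by (intro mult_left_mono noisy_pairs_close[OF M half tk(1,2) _ _ T0 TT]) auto
    finally show "pexp (flip_pair t) ?I N \<le> \<alpha> * s * (2 * T powr e)" .
  qed simp
  \<comment> \<open>\<open>448 = 4 * 56 * 2\<close>, from the quarter of far pairs, the noise
    inequality and the bound for noisy pairs.\<close>
  finally have "s * (k / 50) powr e \<le> s * (448 * real m * \<alpha> * T powr e)"
    by (simp add: mult_ac)
  then have "(k / 50) powr e \<le> 448 * real m * \<alpha> * T powr e" using s by simp
  moreover have "(k / 50) powr e = T powr e * ((real m)\<^sup>2 / 150) powr e"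
    using m1 by (simp add: T_def flip: powr_mult)
  ultimately have "T powr e * ((real m)\<^sup>2 / 150) powr e \<le> T powr e * (448 * real m * \<alpha>)"
    by (simp add: mult_ac)
  then have "((real m)\<^sup>2 / 150) powr e \<le> 448 * real m * \<alpha>" using T0 by simp
  moreover have "((real m)\<^sup>2 / 150) powr e = real m powr (2 * e) / 150 powr e"
    using m1 by (simp add: powr_divide powr_powr flip: powr_numeral)
  \<comment> \<open>\<open>150 = 50 * 3\<close> combines the radius \<open>k / 50\<close> with the 3
    in \<open>T\<close>; then \<open>67200 = 448 * 150\<close>.\<close>
  moreover have "(150::real) powr e \<le> 150" using powr_mono[of e 1 150] e by simp
  then have "real m powr (2 * e) / 150 \<le> real m powr (2 * e) / 150 powr e"
    by (intro divide_left_mono) auto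
  ultimately have "real m powr (2 * e) / 150 \<le> 448 * real m * \<alpha>" by linarith
  moreover have "real m powr (2 * e) = real m * real m powr (2 * e - 1)"
    using m1 by (simp add: powr_diff)
  ultimately have "real m * real m powr (2 * e - 1) \<le> real m * (67200 * \<alpha>)" by simp
  then show ?thesis using m1 by simp
qed

end

section \<open>Choice of the scale and conclusion\<close>

lemma exists_scale:
  fixes k :: nat
  assumes "ln k \<ge> 25"
  shows "\<exists>m\<ge>1. 5000 * real m ^ 5 * 81 ^ m\<^sup>2 \<le> k \<and> ln k \<le> 100 * (real m)\<^sup>2"
proof -
  define r where "r = sqrt (ln k / 25)"
  \<comment> \<open>Rounding down loses at most a factor 2 because \<open>r \<ge> 1\<close>, so
    \<open>ln k = 25 * r^2\<close> is at most \<open>100 * m^2\<close>.\<close>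
  define m where "m = nat \<lfloor>r\<rfloor>"
  have r: "r \<ge> 1" using assms by (simp add: r_def)
  have r2: "r\<^sup>2 = ln k / 25" using assms by (simp add: r_def)
  have m1: "m \<ge> 1" using r by (simp add: m_def le_nat_floor)
  have mr: "real m \<le> r" "r \<le> 2 * real m" using r m1 unfolding m_def by linarith+
  have k: "k > 0" using assms by (cases "k = 0") auto
  have e2: "(2::real) ^ n \<le> exp n" for n :: nat
    using power_mono[of "2::real" "exp 1" n] exp_ge_add_one_self[of "1::real"] exp_of_nat_mult[of n "1::real"] by simp
  have "25 * (real m)\<^sup>2 \<le> 25 * r\<^sup>2" using mr by (intro mult_left_mono power_mono) auto
  then have m25: "25 * (real m)\<^sup>2 \<le> ln k" using r2 by simp
  have sq: "1 \<le> m\<^sup>2" "m \<le> m\<^sup>2" using m1 by (simp_all add: power2_eq_square)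
  \<comment> \<open>The exponents add up to \<open>13 + 5 + 7 = 25\<close>, which is the 25 in the
    definition of \<open>r\<close>.\<close>
  have "5000 * real m ^ 5 * 81 ^ m\<^sup>2 \<le> 2 ^ (13 * m\<^sup>2) * 2 ^ (5 * m\<^sup>2) * 2 ^ (7 * m\<^sup>2)"
  proof (intro mult_mono)
    have "(5000::real) \<le> 2 ^ 13" by simp
    also have "\<dots> \<le> 2 ^ (13 * m\<^sup>2)" using sq by (intro power_increasing) auto
    finally show "(5000::real) \<le> 2 ^ (13 * m\<^sup>2)" .
    have "real m \<le> 2 ^ m" using less_exp[of m] by (simp flip: of_nat_less_iff)
    also have "\<dots> \<le> 2 ^ m\<^sup>2" using sq by (intro power_increasing) auto
    finally have "real m ^ 5 \<le> (2 ^ m\<^sup>2) ^ 5" by (intro power_mono) auto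
    then show "real m ^ 5 \<le> 2 ^ (5 * m\<^sup>2)" by (simp flip: power_mult add: mult.commute)
    have "(81::real) ^ m\<^sup>2 \<le> (2 ^ 7) ^ m\<^sup>2" by (intro power_mono) auto
    then show "(81::real) ^ m\<^sup>2 \<le> 2 ^ (7 * m\<^sup>2)" unfolding power_mult .
  qed auto
  also have "\<dots> = 2 ^ (25 * m\<^sup>2)" by (simp flip: power_add)
  also have "\<dots> \<le> exp (real (25 * m\<^sup>2))" by (rule e2)
  also have "\<dots> \<le> exp (ln k)" using m25 by simp
  also have "\<dots> = k" using k by simp
  finally have "5000 * real m ^ 5 * 81 ^ m\<^sup>2 \<le> k" .
  moreover have "r\<^sup>2 \<le> (2 * real m)\<^sup>2" using mr r by (intro power_mono) auto
  then have "ln k \<le> 100 * (real m)\<^sup>2" using r2 by (simp add: power_mult_distrib)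
  ultimately show ?thesis using m1 by blast
qed

theorem theorem1p7:
  shows "\<exists>c::real. c > 0 \<and>
    (\<forall>(k::nat) (\<epsilon>::real) (G :: (nat \<Rightarrow> nat) set) (M :: (nat \<Rightarrow> bit) set).
       k \<ge> 1 \<longrightarrow> 0 < \<epsilon> \<longrightarrow> \<epsilon> < 1/2 \<longrightarrow>
       subgroup G (sym_group k) \<longrightarrow> transitive_perms k G \<longrightarrow>
       real (card G) \<le> 2 powr (real k / 2) \<longrightarrow>
       M \<subseteq> cube k \<longrightarrow>
       real (card (cube k - M)) \<le> 2 ^ k / sqrt (ln (real k)) \<longrightarrow>
       ereal (c * ln (real k) powr (1/2 - \<epsilon>))
         \<le> c1 (cube_orbit k G ` M) (\<lambda>A B. real (orbit_dist k A B) powr (1 - \<epsilon>)))"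
\<comment> \<open>\<open>6720000 = 67200 * 100\<close>, with 67200 from
  \<open>distortion_lower_bound\<close> and 100 from \<open>ln k \<le> 100 * m^2\<close>.\<close>
proof (intro exI[of _ "1 / 6720000"] conjI allI impI)
  fix k :: nat and \<epsilon> :: real and G :: "(nat \<Rightarrow> nat) set" and M :: "(nat \<Rightarrow> bit) set"
  assume k: "k \<ge> 1" and \<epsilon>: "0 < \<epsilon>" "\<epsilon> < 1/2"
    and G: "subgroup G (sym_group k)" and trans: "transitive_perms k G"
    and card: "real (card G) \<le> 2 powr (real k / 2)" and M: "M \<subseteq> cube k"
    and Mc: "real (card (cube k - M)) \<le> 2 ^ k / sqrt (ln (real k))"
  have L0: "ln (real k) \<ge> 0" using k by simp
  have "1 / 6720000 * ln (real k) powr (1/2 - \<epsilon>) \<le> \<alpha>"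
    if \<alpha>: "\<alpha> \<ge> 1" and emb: "embeds_L1 \<mu> (cube_orbit k G ` M) (\<lambda>A B. real (orbit_dist k A B) powr (1 - \<epsilon>)) \<alpha>"
    for \<alpha> and \<mu> :: "((nat \<Rightarrow> bit) set \<Rightarrow> real) measure"
  proof (cases "ln (real k) \<ge> 25")
    \<comment> \<open>For bounded \<open>k\<close> the constant is so small that
      \<open>\<alpha> \<ge> 1\<close> suffices; this covers \<open>k = 1\<close>, where the
      logarithm is 0.\<close>
    case False
    then have "ln (real k) powr (1/2 - \<epsilon>) \<le> 25 powr (1/2 - \<epsilon>)"
      using L0 \<epsilon> by (intro powr_mono2) auto
    also have "\<dots> \<le> 25 powr 1" using \<epsilon> by (intro powr_mono) auto
    finally show ?thesis using \<alpha> by simp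
  next
    case True
    then obtain m where m: "m \<ge> 1" "5000 * real m ^ 5 * 81 ^ m\<^sup>2 \<le> k" "ln k \<le> 100 * (real m)\<^sup>2"
      using exists_scale by blast
    have "4 \<le> sqrt (ln (real k))" using True by (intro real_le_rsqrt) simp
    then have "2 ^ k / sqrt (ln (real k)) \<le> 2 ^ k / 4" using True by (intro divide_left_mono) auto
    with Mc have M4: "real (card (cube k - M)) \<le> 2 ^ k / 4" by linarith
    have "real m powr (2 * (1 - \<epsilon>) - 1) \<le> 67200 * \<alpha>"
      by (rule distortion_lower_bound[OF G trans card M M4 m(1,2) _ _ emb \<alpha>]) (use \<epsilon> in auto)
    moreover have "ln (real k) powr (1/2 - \<epsilon>) \<le> 100 * real m powr (2 * (1 - \<epsilon>) - 1)"
    proof -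
      have "ln (real k) powr (1/2 - \<epsilon>) \<le> (100 * (real m)\<^sup>2) powr (1/2 - \<epsilon>)"
        using m(3) L0 \<epsilon> by (intro powr_mono2) auto
      also have "\<dots> = 100 powr (1/2 - \<epsilon>) * (real m powr 2) powr (1/2 - \<epsilon>)"
        using m(1) by (simp add: powr_mult)
      also have "(real m powr 2) powr (1/2 - \<epsilon>) = real m powr (2 * (1 - \<epsilon>) - 1)"
        unfolding powr_powr by (simp add: algebra_simps)
      also have "100 powr (1/2 - \<epsilon>) \<le> (100::real) powr 1" using \<epsilon> by (intro powr_mono) auto
      finally show ?thesis by (simp add: mult_right_mono)
    qed
    ultimately show ?thesis by simp
  qed
  then show "ereal (1 / 6720000 * ln (real k) powr (1/2 - \<epsilon>))
      \<le> c1 (cube_orbit k G ` M) (\<lambda>A B. real (orbit_dist k A B) powr (1 - \<epsilon>))"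
    unfolding c1_def by (intro Inf_greatest) auto
qed simp

end
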